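(* There is a constant $C$ such that for every even integer $n\geq 10$ there exists a latin square $L$ of order $n$ satisfying $n^2>\tau(L)\geq \tfrac{19}{36}n^2 - Cn$. (In the paper's notation: $n^2>\tau(L)\ge 19n^2/36+O(n)$.)
   Context: A latin square of order $n$ is an $n\times n$ array on $n$ symbols in which each symbol occurs exactly once in each row and each column; it is viewed as the set of $n^2$ entries $(r,c,s)$ (symbol $s$ in row $r$, column $c$). A transversal is a set of $n$ entries containing each row, each column and each symbol exactly once. An entry is transversal-free if it lies in no transversal, and $\tau(L)$ denotes the number of transversal-free entries of $L$ (so $\tau(L)<n^2$ means $L$ has at least one transversal). *)

theory Defs
  imports Complex_Main
begin

type_synonym entry = "nat \<times> nat \<times> nat"

definition latin_square :: "nat \<Rightarrow> entry set \<Rightarrow> bool" where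
  "latin_square n L \<longleftrightarrow>
     L \<subseteq> {0..<n} \<times> {0..<n} \<times> {0..<n} \<and>
     (\<forall>r<n. \<forall>c<n. \<exists>!s. (r, c, s) \<in> L) \<and>
     (\<forall>r<n. \<forall>s<n. \<exists>!c. (r, c, s) \<in> L) \<and>
     (\<forall>c<n. \<forall>s<n. \<exists>!r. (r, c, s) \<in> L)"

definition transversal :: "nat \<Rightarrow> entry set \<Rightarrow> entry set \<Rightarrow> bool" where
  "transversal n L T \<longleftrightarrow>
     T \<subseteq> L \<and> card T = n \<and>
     (\<lambda>(r, c, s). r) ` T = {0..<n} \<and>
     (\<lambda>(r, c, s). c) ` T = {0..<n} \<and>
     (\<lambda>(r, c, s). s) ` T = {0..<n}"

definition transversal_free :: "nat \<Rightarrow> entry set \<Rightarrow> entry \<Rightarrow> bool" where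
  "transversal_free n L e \<longleftrightarrow> e \<in> L \<and> \<not> (\<exists>T. transversal n L T \<and> e \<in> T)"

definition tau :: "nat \<Rightarrow> entry set \<Rightarrow> nat" where
  "tau n L = card {e. transversal_free n L e}"

end

theory Submission
  imports Defs "HOL-Number_Theory.Cong" "HOL-Combinatorics.Transposition"
begin

text \<open>
Modify the addition table of the integers modulo \<open>n = 2 m\<close>: entry \<open>(r, c)\<close> carries the symbol
\<open>c + g r c\<close>, where for every column \<open>c\<close> the map \<open>r \<mapsto> g r c\<close> permutes the rows inside small blocks
of three rows. With \<open>v r\<close> the largest row of the block of \<open>r\<close>, always \<open>g r c \<le> v r\<close>. Along a
transversal the deficits \<open>v r - g r c\<close> sum to \<open>0\<close> modulo \<open>n\<close> once \<open>v\<close> sums to \<open>0\<close>, and blocks can be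
chosen so that this sum is less than \<open>n\<close>. Hence every entry of a transversal has \<open>g r c = v r\<close>.
Nearly all blocks are bands of consecutive rows, about \<open>n/6\<close> of them. In each band the first row
attains \<open>v r\<close> only at a private column and at one column \<open>a\<close>, and \<open>a\<close> is always taken by one of two
anchor bands, so all transversals share about \<open>n/6\<close> entries. Counting the entries in conflict with
these, or with \<open>g r c < v r\<close>, gives \<open>19/36\<close> of the square. That some transversal exists follows from
Marshall Hall's theorem on prescribed differences of permutations applied to \<open>v\<close>: the three columns
it assigns to each block determine how that block is to be arranged.
\<close>

subsection \<open>Permutations with prescribed differences\<close>

text \<open>Follow the orbit of \<open>b\<close> under \<open>\<theta>\<close> until it first meets
  \<open>a\<close> or \<open>b\<close>. If it returns to \<open>b\<close>, the cycle traversed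
  avoids \<open>a\<close>. If it meets \<open>a\<close>, the transposition redirects that last step
  to \<open>b\<close> and closes the path into a cycle.\<close>

lemma separating_invariant_set:
  fixes \<theta> :: "'r \<Rightarrow> 'r"
  assumes R: "finite R" "bij_betw \<theta> R R" and ab: "a \<in> R" "b \<in> R" "a \<noteq> b"
  obtains X where "X \<subseteq> R" "b \<in> X" "a \<notin> X" "\<theta> ` X = X \<or> (transpose a b \<circ> \<theta>) ` X = X"
proof -
  define f where "f i = (\<theta> ^^ i) b" for i
  have fR: "f i \<in> R" for i
    by (induction i) (use R ab in \<open>auto simp: f_def bij_betw_def\<close>)
  have inj: "inj_on \<theta> R" using R by (simp add: bij_betw_def)
  have fS: "f (Suc i) = \<theta> (f i)" for i by (simp add: f_def)
  have ex: "\<exists>j>0. f j = b"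
  proof -
    have "\<not> inj f" using R(1) fR
      by (meson finite_subset image_subsetI infinite_UNIV_nat finite_imageD)
    then obtain i j where ij: "i < j" "f i = f j"
      by (metis injI linorder_neqE_nat)
    \<comment> \<open>A coincidence \<open>f i = f j\<close> is pulled back to
      \<open>f 0 = b\<close> by cancelling the injective \<open>\<theta>\<close>.\<close>
    have "f (j - i) = b" using ij
    proof (induction i arbitrary: j)
      case 0 then show ?case by (simp add: f_def)
    next
      case (Suc i)
      then obtain j' where j': "j = Suc j'" using less_imp_Suc_add by blast
      have "f i = f j'" using Suc(3) j' inj fR unfolding fS by (metis fS inj_onD)
      then show ?case using Suc j' by simp
    qed
    then show ?thesis using ij by (intro exI[of _ "j - i"]) auto
  qed
  define j where "j = (LEAST j. j > 0 \<and> (f j = a \<or> f j = b))"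
  have j: "j > 0" "f j = a \<or> f j = b"
    using LeastI_ex[of "\<lambda>j. j > 0 \<and> (f j = a \<or> f j = b)"] ex unfolding j_def by auto
  have least: "f i \<noteq> a \<and> f i \<noteq> b" if "0 < i" "i < j" for i
    using not_less_Least[of i "\<lambda>j. j > 0 \<and> (f j = a \<or> f j = b)"] that unfolding j_def by auto
  define X where "X = f ` {..<j}"
  have f0: "f 0 = b" by (simp add: f_def)
  have X: "X = insert b (f ` {0<..<j})"
  proof -
    have "{..<j} = insert 0 {0<..<j}" using j by auto
    then show ?thesis by (simp add: X_def f0)
  qed
  have tX: "\<theta> ` X = insert (f j) (f ` {0<..<j})"
  proof -
    have "\<theta> ` X = f ` Suc ` {..<j}" by (auto simp: X_def image_image fS)
    also have "Suc ` {..<j} = insert j {0<..<j}"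
    proof -
      have "x \<in> Suc ` {..<j}" if "x = j \<or> 0 < x \<and> x < j" for x
        using that j(1) by (cases x) auto
      then show ?thesis by auto
    qed
    finally show ?thesis by simp
  qed
  show thesis
  proof (rule that[of X])
    show "X \<subseteq> R" using fR by (auto simp: X_def)
    show "b \<in> X" by (simp add: X)
    show "a \<notin> X" using least ab(3) unfolding X by (metis greaterThanLessThan_iff imageE insertE)
    show "\<theta> ` X = X \<or> (transpose a b \<circ> \<theta>) ` X = X"
    proof (cases "f j = b")
      case True then show ?thesis using tX X by simp
    next
      case False
      have "transpose a b (f i) = f i" if "i \<in> {0<..<j}" for i
        using least that by (intro transpose_apply_other) auto
      then have "transpose a b ` f ` {0<..<j} = f ` {0<..<j}"
        by (simp add: image_image)
      moreover have "(transpose a b \<circ> \<theta>) ` X = transpose a b ` \<theta> ` X"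
        by (simp only: image_comp)
      ultimately have "(transpose a b \<circ> \<theta>) ` X = X"
        using False j unfolding X tX[unfolded X] by (metis image_insert transpose_apply_first)
      then show ?thesis ..
    qed
  qed
qed

text \<open>Reflecting the columns and symbols of \<open>X\<close> by \<open>\<psi>\<close> exchanges their roles and so keeps every
difference. Afterwards a single transposition of symbols repairs row \<open>a\<close> at the expense of \<open>b\<close>.\<close>

lemma redistribute_differences_invariant:
  fixes \<sigma> \<tau> :: "'r \<Rightarrow> int" and n p :: int
  assumes R: "finite R" and n: "n > 0"
    and \<sigma>: "bij_betw \<sigma> R {0..<n}" and \<tau>: "bij_betw \<tau> R {0..<n}"
    and ab: "a \<in> R" "b \<in> R" "a \<noteq> b"
    and \<psi>: "\<psi> = (\<lambda>x. (p + \<sigma> a + \<sigma> b - x) mod n)"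
    and X: "X \<subseteq> R" "b \<in> X" "a \<notin> X" "\<tau> ` X = \<psi> ` \<sigma> ` X"
  shows "\<exists>\<sigma>' \<tau>'. bij_betw \<sigma>' R {0..<n} \<and> bij_betw \<tau>' R {0..<n} \<and>
    [\<tau>' a - \<sigma>' a = p] (mod n) \<and>
    (\<forall>r \<in> R - {a, b}. [\<tau>' r - \<sigma>' r = \<tau> r - \<sigma> r] (mod n))"
proof -
  have \<psi>\<psi>: "\<psi> (\<psi> x) = x" if "x \<in> {0..<n}" for x
    using that by (simp add: \<psi> mod_diff_right_eq)
  have \<psi>_in: "\<psi> x \<in> {0..<n}" for x using n by (simp add: \<psi>)
  have inj\<psi>: "inj_on \<psi> {0..<n}" by (metis \<psi>\<psi> inj_onI)
  have inj\<sigma>: "inj_on \<sigma> R" and inj\<tau>: "inj_on \<tau> R" and im\<sigma>: "\<sigma> ` R = {0..<n}" and im\<tau>: "\<tau> ` R = {0..<n}"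
    using \<sigma> \<tau> by (auto simp: bij_betw_def)
  have \<sigma>X: "\<sigma> ` X \<subseteq> {0..<n}" using X im\<sigma> by blast
  \<comment> \<open>The hypothesis on \<open>X\<close> says that reflection exchanges the columns
    and the symbols of \<open>X\<close>, so \<open>s\<close> and \<open>t\<close> only rearrange
    values within the old images of \<open>X\<close> and stay bijective.\<close>
  define s where "s r = (if r \<in> X then \<psi> (\<tau> r) else \<sigma> r)" for r
  define t where "t r = (if r \<in> X then \<psi> (\<sigma> r) else \<tau> r)" for r
  have "s ` X = \<psi> ` \<tau> ` X" by (auto simp: s_def image_image)
  also have "\<dots> = \<sigma> ` X" unfolding X(4)
    using \<psi>\<psi> \<sigma>X by (force simp: image_iff)
  finally have sX: "s ` X = \<sigma> ` X" .
  have tX: "t ` X = \<tau> ` X" unfolding X(4) by (auto simp: t_def image_image)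
  have sR: "s ` R = {0..<n}"
  proof -
    have "s ` (R - X) = \<sigma> ` (R - X)" by (auto simp: s_def)
    then have "s ` (X \<union> (R - X)) = \<sigma> ` (X \<union> (R - X))" using sX unfolding image_Un by simp
    then show ?thesis using X(1) im\<sigma> by (simp add: Un_absorb1)
  qed
  have tR: "t ` R = {0..<n}"
  proof -
    have "t ` (R - X) = \<tau> ` (R - X)" by (auto simp: t_def)
    then have "t ` (X \<union> (R - X)) = \<tau> ` (X \<union> (R - X))" using tX unfolding image_Un by simp
    then show ?thesis using X(1) im\<tau> by (simp add: Un_absorb1)
  qed
  have cR: "card R = card {0..<n}" using \<sigma> by (rule bij_betw_same_card)
  have s: "bij_betw s R {0..<n}"
    unfolding bij_betw_def using sR cR R by (metis eq_card_imp_inj_on)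
  have t: "bij_betw t R {0..<n}"
    unfolding bij_betw_def using tR cR R by (metis eq_card_imp_inj_on)
  \<comment> \<open>Because \<open>\<psi>\<close> reflects with the constant
    \<open>p + \<sigma> a + \<sigma> b\<close>, \<open>t b\<close> is \<open>p + \<sigma> a\<close>
    modulo \<open>n\<close>. Moved to row \<open>a\<close>, whose column is still
    \<open>\<sigma> a\<close>, this symbol gives the difference \<open>p\<close>.\<close>
  define t' where "t' = t \<circ> transpose a b"
  have "bij_betw (transpose a b) R R" using ab by (simp add: bij_betw_transpose_iff)
  then have t': "bij_betw t' R {0..<n}" unfolding t'_def using t bij_betw_trans by blast
  have ta: "t' a = \<psi> (\<sigma> b)" using X by (simp add: t'_def t_def)
  have sa: "s a = \<sigma> a" using X by (simp add: s_def)
  have "[t' a - s a = p] (mod n)"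
    unfolding ta sa \<psi> cong_def by (simp add: mod_diff_left_eq)
  moreover have "[t' r - s r = \<tau> r - \<sigma> r] (mod n)" if r: "r \<in> R - {a, b}" for r
  proof (cases "r \<in> X")
    case True
    have "t' r = \<psi> (\<sigma> r)" using r True by (auto simp: t'_def t_def transpose_def)
    moreover have "s r = \<psi> (\<tau> r)" using True by (simp add: s_def)
    ultimately show ?thesis by (simp add: \<psi> cong_def mod_diff_eq)
  next
    case False
    then show ?thesis using r by (auto simp: t'_def t_def s_def transpose_def)
  qed
  ultimately show ?thesis using s t' by blast
qed

text \<open>Invariance of \<open>X\<close> under \<open>\<theta>\<close> is the hypothesis of the
  preceding lemma. If \<open>X\<close> is invariant only after the transposition, first swapping the
  symbols of rows \<open>a\<close> and \<open>b\<close> restores that hypothesis and alters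
  differences in these two rows only.\<close>

lemma redistribute_differences:
  fixes \<sigma> \<tau> :: "'r \<Rightarrow> int" and n p :: int
  assumes R: "finite R" and n: "n > 0"
    and \<sigma>: "bij_betw \<sigma> R {0..<n}" and \<tau>: "bij_betw \<tau> R {0..<n}"
    and ab: "a \<in> R" "b \<in> R" "a \<noteq> b"
  shows "\<exists>\<sigma>' \<tau>'. bij_betw \<sigma>' R {0..<n} \<and> bij_betw \<tau>' R {0..<n} \<and>
    [\<tau>' a - \<sigma>' a = p] (mod n) \<and>
    (\<forall>r \<in> R - {a, b}. [\<tau>' r - \<sigma>' r = \<tau> r - \<sigma> r] (mod n))"
proof -
  define \<psi> where "\<psi> = (\<lambda>x. (p + \<sigma> a + \<sigma> b - x) mod n)"
  define \<theta> where "\<theta> = inv_into R \<tau> \<circ> (\<psi> \<circ> \<sigma>)"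
  have \<psi>\<psi>: "\<psi> (\<psi> x) = x" if "x \<in> {0..<n}" for x
    using that by (simp add: \<psi>_def mod_diff_right_eq)
  have \<psi>_in: "\<psi> x \<in> {0..<n}" for x using n by (simp add: \<psi>_def)
  have \<psi>: "bij_betw \<psi> {0..<n} {0..<n}"
    by (rule bij_betw_byWitness[of _ \<psi>]) (use \<psi>\<psi> \<psi>_in in auto)
  have \<theta>: "bij_betw \<theta> R R" unfolding \<theta>_def
    using bij_betw_trans[OF bij_betw_trans[OF \<sigma> \<psi>] bij_betw_inv_into[OF \<tau>]] .
  have im: "\<tau> ` \<theta> ` X = \<psi> ` \<sigma> ` X" if "X \<subseteq> R" for X
  proof -
    have "\<tau> (\<theta> r) = \<psi> (\<sigma> r)" for r
      unfolding \<theta>_def using \<psi>_in \<tau> by (simp add: bij_betw_def f_inv_into_f)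
    then show ?thesis by (simp add: image_image)
  qed
  obtain X where X: "X \<subseteq> R" "b \<in> X" "a \<notin> X" "\<theta> ` X = X \<or> (transpose a b \<circ> \<theta>) ` X = X"
    using separating_invariant_set[OF R \<theta> ab] .
  from X(4) show ?thesis
  proof
    assume "\<theta> ` X = X"
    then have "\<tau> ` X = \<psi> ` \<sigma> ` X" using im[OF X(1)] by simp
    from redistribute_differences_invariant[OF R n \<sigma> \<tau> ab \<psi>_def X(1-3) this] show ?thesis .
  next
    assume 1: "(transpose a b \<circ> \<theta>) ` X = X"
    define \<tau>2 where "\<tau>2 = \<tau> \<circ> transpose a b"
    have "bij_betw (transpose a b) R R" using ab by (simp add: bij_betw_transpose_iff)
    then have \<tau>2: "bij_betw \<tau>2 R {0..<n}" unfolding \<tau>2_def using \<tau> bij_betw_trans by blast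
    have "\<tau>2 ` X = \<tau> ` transpose a b ` (transpose a b \<circ> \<theta>) ` X"
      unfolding 1 by (simp add: \<tau>2_def image_comp)
    also have "\<dots> = \<tau> ` \<theta> ` X" by (simp add: image_comp comp_def)
    finally have "\<tau>2 ` X = \<psi> ` \<sigma> ` X" using im[OF X(1)] by simp
    from redistribute_differences_invariant[OF R n \<sigma> \<tau>2 ab \<psi>_def X(1-3) this]
    obtain \<sigma>' \<tau>' where st: "bij_betw \<sigma>' R {0..<n}" "bij_betw \<tau>' R {0..<n}"
      "[\<tau>' a - \<sigma>' a = p] (mod n)"
      "\<forall>r \<in> R - {a, b}. [\<tau>' r - \<sigma>' r = \<tau>2 r - \<sigma> r] (mod n)" by blast
    have "\<tau>2 r = \<tau> r" if "r \<in> R - {a, b}" for r using that by (auto simp: \<tau>2_def transpose_def)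
    then show ?thesis using st by (intro exI[of _ \<sigma>'] exI[of _ \<tau>']) auto
  qed
qed

text \<open>The rows are corrected one at a time, row \<open>n - 1\<close> absorbing every error.
  That row ends up correct by itself: both bijections have the same sum, so the differences sum to
  \<open>0\<close>, as \<open>v\<close> does modulo \<open>n\<close>.\<close>

theorem Hall_differences:
  fixes v :: "nat \<Rightarrow> int" and n :: nat
  assumes n: "n > 0" and sum: "[(\<Sum>r<n. v r) = 0] (mod int n)"
  obtains \<sigma> where "bij_betw \<sigma> {..<n} {0..<int n}"
    "bij_betw (\<lambda>r. (v r + \<sigma> r) mod int n) {..<n} {0..<int n}"
proof -
  have step: "\<exists>\<sigma> \<tau>. bij_betw \<sigma> {..<n} {0..<int n} \<and> bij_betw \<tau> {..<n} {0..<int n} \<and>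
    (\<forall>r<k. [\<tau> r - \<sigma> r = v r] (mod int n))" if "k < n" for k
    using that
  proof (induction k)
    case 0
    have "bij_betw int {..<n} {0..<int n}"
      by (rule bij_betw_byWitness[of _ nat]) auto
    then show ?case by blast
  next
    case (Suc k)
    then obtain \<sigma> \<tau> where st: "bij_betw \<sigma> {..<n} {0..<int n}" "bij_betw \<tau> {..<n} {0..<int n}"
      "\<forall>r<k. [\<tau> r - \<sigma> r = v r] (mod int n)" by auto
    have ab: "k \<in> {..<n}" "n - 1 \<in> {..<n}" "k \<noteq> n - 1" using Suc.prems by auto
    obtain \<sigma>' \<tau>' where st': "bij_betw \<sigma>' {..<n} {0..<int n}" "bij_betw \<tau>' {..<n} {0..<int n}"
      "[\<tau>' k - \<sigma>' k = v k] (mod int n)"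
      "\<forall>r \<in> {..<n} - {k, n - 1}. [\<tau>' r - \<sigma>' r = \<tau> r - \<sigma> r] (mod int n)"
      using redistribute_differences[OF _ _ st(1,2) ab, of "v k"] n by auto
    have "[\<tau>' r - \<sigma>' r = v r] (mod int n)" if "r < Suc k" for r
    proof (cases "r = k")
      case False
      then have "r < k" "r \<in> {..<n} - {k, n - 1}" using that Suc.prems by auto
      then show ?thesis using st(3) st'(4) cong_trans by blast
    qed (use st' in simp)
    then show ?case using st' by blast
  qed
  obtain \<sigma> \<tau> where st: "bij_betw \<sigma> {..<n} {0..<int n}" "bij_betw \<tau> {..<n} {0..<int n}"
    "\<forall>r<n - 1. [\<tau> r - \<sigma> r = v r] (mod int n)" using step[of "n - 1"] n by auto
  have n': "{..<n} = insert (n - 1) {..<n - 1}" using n by auto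
  have "(\<Sum>r<n. \<tau> r) = (\<Sum>r<n. \<sigma> r)"
    using sum.reindex_bij_betw[OF st(1), of "\<lambda>x. x"] sum.reindex_bij_betw[OF st(2), of "\<lambda>x. x"] by simp
  then have "(\<Sum>r<n. \<tau> r - \<sigma> r - v r) = - (\<Sum>r<n. v r)"
    by (simp add: sum_subtractf)
  moreover have "(\<Sum>r<n. \<tau> r - \<sigma> r - v r) = (\<tau> (n - 1) - \<sigma> (n - 1) - v (n - 1)) + (\<Sum>r<n - 1. \<tau> r - \<sigma> r - v r)"
    unfolding n' by simp
  moreover have "int n dvd (\<Sum>r<n - 1. \<tau> r - \<sigma> r - v r)"
    by (rule dvd_sum) (use st(3) in \<open>auto simp: cong_iff_dvd_diff\<close>)
  moreover have "int n dvd (\<Sum>r<n. v r)" using sum by (simp add: cong_0_iff)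
  ultimately have "int n dvd - (\<Sum>r<n. v r) - (\<Sum>r<n - 1. \<tau> r - \<sigma> r - v r)"
    and "\<tau> (n - 1) - \<sigma> (n - 1) - v (n - 1) = - (\<Sum>r<n. v r) - (\<Sum>r<n - 1. \<tau> r - \<sigma> r - v r)"
    by (auto intro: dvd_diff)
  then have "int n dvd \<tau> (n - 1) - \<sigma> (n - 1) - v (n - 1)" by simp
  then have all: "[\<tau> r - \<sigma> r = v r] (mod int n)" if "r < n" for r
    using that st(3) by (cases "r = n - 1") (auto simp: cong_iff_dvd_diff)
  have "(v r + \<sigma> r) mod int n = \<tau> r" if "r < n" for r
  proof -
    have "\<tau> r \<in> {0..<int n}" using st(2) that by (auto simp: bij_betw_def)
    moreover have "[v r + \<sigma> r = \<tau> r] (mod int n)"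
      using all[OF that] by (simp add: cong_iff_dvd_diff algebra_simps dvd_diff_commute)
    ultimately show ?thesis by (auto simp: cong_def)
  qed
  then have "bij_betw (\<lambda>r. (v r + \<sigma> r) mod int n) {..<n} {0..<int n}"
    using st(2) bij_betw_cong[of "{..<n}" "\<lambda>r. (v r + \<sigma> r) mod int n" \<tau>] by simp
  with st(1) show thesis using that by blast
qed

subsection \<open>Squares obtained by permuting shifts\<close>

definition shifted_square :: "nat \<Rightarrow> (nat \<Rightarrow> nat \<Rightarrow> nat) \<Rightarrow> entry set" where
  "shifted_square n g = {(r, c, s). r < n \<and> c < n \<and> s = (c + g r c) mod n}"

lemma ex1_of_inj_on:
  assumes "inj_on f {..<n}" "f ` {..<n} \<subseteq> {..<n}" "s < (n::nat)"
  shows "\<exists>!x. x < n \<and> f x = s"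
proof -
  have "f ` {..<n} = {..<n}" using assms(1,2) by (simp add: endo_inj_surj)
  then obtain x where "x < n" "f x = s" using assms(3) by (metis imageE lessThan_iff)
  then show ?thesis using assms(1) by (intro ex1I[of _ x]) (auto simp: inj_on_def)
qed

lemma latin_square_shifted:
  assumes less: "\<And>r c. r < n \<Longrightarrow> c < n \<Longrightarrow> g r c < n"
    and col: "\<And>c. c < n \<Longrightarrow> inj_on (\<lambda>r. g r c) {..<n}"
    and row: "\<And>r. r < n \<Longrightarrow> inj_on (\<lambda>c. (c + g r c) mod n) {..<n}"
  shows "latin_square n (shifted_square n g)"
proof (cases "n = 0")
  case True then show ?thesis by (simp add: latin_square_def shifted_square_def)
next
  case False
  have "\<exists>!c. (r, c, s) \<in> shifted_square n g" if "r < n" "s < n" for r s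
  proof -
    have "\<exists>!c. c < n \<and> (c + g r c) mod n = s"
      by (rule ex1_of_inj_on) (use row that in auto)
    moreover have "(r, c, s) \<in> shifted_square n g \<longleftrightarrow> c < n \<and> (c + g r c) mod n = s" for c
      using that by (auto simp: shifted_square_def)
    ultimately show ?thesis by simp
  qed
  moreover have "\<exists>!r. (r, c, s) \<in> shifted_square n g" if "c < n" "s < n" for c s
  proof -
    have "inj_on (\<lambda>r. (c + g r c) mod n) {..<n}"
    proof (rule inj_onI)
      fix r r' assume r: "r \<in> {..<n}" "r' \<in> {..<n}" and "(c + g r c) mod n = (c + g r' c) mod n"
      then have "[g r c = g r' c] (mod n)"
        by (simp only: cong_add_lcancel_nat[of c] flip: cong_def)
      then have "g r c = g r' c" using less r that by (simp add: cong_less_modulus_unique_nat)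
      then show "r = r'" using col[OF that(1)] r by (meson inj_onD)
    qed
    then have "\<exists>!r. r < n \<and> (c + g r c) mod n = s"
      by (rule ex1_of_inj_on) (use that in auto)
    moreover have "(r, c, s) \<in> shifted_square n g \<longleftrightarrow> r < n \<and> (c + g r c) mod n = s" for r
      using that by (auto simp: shifted_square_def)
    ultimately show ?thesis by simp
  qed
  moreover have "\<exists>!s. (r, c, s) \<in> shifted_square n g" if "r < n" "c < n" for r c
    using that by (simp add: shifted_square_def)
  moreover have "shifted_square n g \<subseteq> {0..<n} \<times> {0..<n} \<times> {0..<n}"
    using False by (auto simp: shifted_square_def)
  ultimately show ?thesis by (simp add: latin_square_def)
qed

text \<open>Words are \<open>n\<close>-periodic functions on the integers, so that neighbours such
  as \<open>x - 1\<close> wrap around without case distinctions.\<close>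

definition word_mod :: "nat \<Rightarrow> (int \<Rightarrow> nat) \<Rightarrow> bool" where
  "word_mod n w \<longleftrightarrow> (\<forall>x y. [x = y] (mod int n) \<longrightarrow> w x = w y)"

lemma word_modD: "word_mod n w \<Longrightarrow> [x = y] (mod int n) \<Longrightarrow> w x = w y"
  by (auto simp: word_mod_def)

text \<open>Colliding columns differ modulo \<open>n\<close> by the difference of their values of
  \<open>f\<close>, which is at most \<open>3\<close>. Injectivity of a row thus becomes a check of
  columns at distance \<open>1\<close>, \<open>2\<close> or \<open>3\<close>.\<close>

lemma inj_on_shift:
  fixes f :: "int \<Rightarrow> nat"
  assumes f: "word_mod n f" and le: "\<And>x. f x \<le> 3"
    and ne: "\<And>x d. d \<in> {1, 2, 3} \<Longrightarrow> f x \<noteq> f (x + int d) + d"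
  shows "inj_on (\<lambda>c. (c + (b + f (int c))) mod n) {..<n}"
proof (rule inj_onI)
  fix c c' assume c: "c \<in> {..<n}" "c' \<in> {..<n}"
    and eq: "(c + (b + f (int c))) mod n = (c' + (b + f (int c'))) mod n"
  have "[b + (c + f (int c)) = b + (c' + f (int c'))] (mod n)"
    using eq by (simp add: cong_def ac_simps)
  then have eq: "[c + f (int c) = c' + f (int c')] (mod n)"
    using cong_add_lcancel_nat by blast
  have *: "f (int c) \<le> f (int c')" if eq: "[c + f (int c) = c' + f (int c')] (mod n)" for c c'
  proof (rule ccontr)
    assume "\<not> ?thesis"
    define d where "d = f (int c) - f (int c')"
    have d: "f (int c) = f (int c') + d" "d \<in> {1, 2, 3}"
      using \<open>\<not> _\<close> le[of "int c"] by (auto simp: d_def)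
    have "[f (int c') + (c + d) = f (int c') + c'] (mod n)"
      using eq d by (simp add: ac_simps)
    then have "[c + d = c'] (mod n)" using cong_add_lcancel_nat by blast
    then have "[int c + int d = int c'] (mod int n)"
      by (metis cong_int_iff of_nat_add)
    then have "f (int c + int d) = f (int c')" by (rule word_modD[OF f])
    then show False using ne[OF d(2), of "int c"] d(1) by simp
  qed
  have "f (int c) = f (int c')" using *[OF eq] *[OF cong_sym[OF eq]] by simp
  then have "[c = c'] (mod n)" using eq cong_add_rcancel_nat by simp
  then show "c = c'" using c by (simp add: cong_less_modulus_unique_nat)
qed

text \<open>Consecutive letters differ so that the largest and the smallest shift in a column fall
  to different rows of a band.\<close>

definition proper_word :: "(int \<Rightarrow> nat) \<Rightarrow> bool" where
  "proper_word w \<longleftrightarrow> (\<forall>x. w x < 3 \<and> w (x + 1) \<noteq> w x)"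

text \<open>In column \<open>x\<close> of a three-row band the row with index \<open>w x\<close> receives the largest shift, and the
row that was largest in column \<open>x - 1\<close> the smallest.\<close>

definition band :: "(int \<Rightarrow> nat) \<Rightarrow> nat \<Rightarrow> int \<Rightarrow> nat" where
  "band w j x = (if w x = j then 2 else if w (x - 1) = j then 0 else 1)"

lemma proper_word_pred: "proper_word w \<Longrightarrow> w (x - 1) \<noteq> w x"
  unfolding proper_word_def by (metis diff_add_cancel)

text \<open>Compared with the constant shift \<open>b + 1\<close>, row \<open>j\<close> interchanges
  the symbols of columns \<open>x\<close> and \<open>x + 1\<close> whenever \<open>w x = j\<close>.
  These pairs are disjoint because consecutive letters differ.\<close>

lemma band_inj_row:
  assumes w: "word_mod n w" "proper_word w"
  shows "inj_on (\<lambda>c. (c + (b + band w j (int c))) mod n) {..<n}"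
proof (rule inj_on_shift)
  have "band w j x = band w j y" if "[x = y] (mod int n)" for x y
  proof -
    have "[x - 1 = y - 1] (mod int n)" using that by (intro cong_diff) auto
    then have "w (x - 1) = w (y - 1)" "w x = w y" using that word_modD[OF w(1)] by blast+
    then show ?thesis by (simp add: band_def)
  qed
  then show "word_mod n (band w j)" by (simp add: word_mod_def)
  have "w x \<noteq> w (x + 1)" for x using w(2) unfolding proper_word_def by metis
  moreover have e: "x + 1 - 1 = x" "x + 2 - 1 = x + 1" "x + 3 - 1 = x + 2" for x :: int by auto
  ultimately have "band w j x \<noteq> band w j (x + 1) + 1" "band w j x \<noteq> band w j (x + 2) + 2"
    "band w j x \<noteq> band w j (x + 3) + 3" for x
    unfolding band_def e by (auto split: if_splits)
  then show "band w j x \<noteq> band w j (x + int d) + d" if "d \<in> {1, 2, 3}" for x d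
    using that by auto
qed (auto simp: band_def)

lemma lessThan_3: "{..<3::nat} = {0, 1, 2}"
  by auto

lemma less_3_cases:
  assumes "k < (3::nat)" obtains "k = 0" | "k = 1" | "k = 2"
  using assms by linarith

lemma band_inj_col:
  assumes w: "proper_word w"
  shows "inj_on (\<lambda>j. band w j x) {..<3}"
proof -
  have "w x < 3" "w (x - 1) < 3" using w by (auto simp: proper_word_def)
  moreover have "w (x - 1) \<noteq> w x" by (rule proper_word_pred[OF w])
  ultimately show ?thesis unfolding lessThan_3 band_def
    by (elim less_3_cases) (simp_all add: inj_on_def)
qed

text \<open>A gadget row of index \<open>0\<close> or \<open>1\<close> that attains \<open>3\<close>
  gets \<open>0\<close> in the next two columns, so equal letters \<open>0\<close> or
  \<open>1\<close> must be at least three apart. Before a letter \<open>2\<close>, exactly one of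
  the two preceding letters is not \<open>2\<close>; it decides which of these two rows gets
  \<open>0\<close>.\<close>

definition spaced_word :: "(int \<Rightarrow> nat) \<Rightarrow> bool" where
  "spaced_word w \<longleftrightarrow> (\<forall>x. w x < 3 \<and> (w x \<noteq> 2 \<longrightarrow> w (x + 1) = 2 \<and> w (x + 2) \<noteq> w x) \<and>
     \<not> (w x = 2 \<and> w (x + 1) = 2 \<and> w (x + 2) = 2))"

text \<open>The analogue for rows \<open>0, 1, 3\<close>. A gadget contributes \<open>(3 - 0) + (3 - 1) + (3 - 3) = 5\<close> to the sum
of \<open>v r - r\<close> and at most \<open>9\<close> to the deficit, a band \<open>3\<close> and at most \<open>6\<close>. As \<open>9 < 2 * 5\<close>, one gadget
suffices to push the largest possible deficit below \<open>n\<close>.\<close>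

definition gadget :: "(int \<Rightarrow> nat) \<Rightarrow> nat \<Rightarrow> int \<Rightarrow> nat" where
  "gadget w j x = (if w x = j then 3
     else if j = 2 then (if w (x - 2) = 2 then 0 else 1)
     else (if w (x - 1) = j \<or> w (x - 2) = j then 0 else 1))"

text \<open>Compared with the constant shift \<open>b + 1\<close>, the rows of index
  \<open>0\<close> and \<open>1\<close> rotate the symbols of the three columns starting at each
  occurrence of their letter. For index \<open>2\<close> the conditions of
  \<open>spaced_word\<close> exclude each possible collision.\<close>

lemma gadget_inj_row:
  assumes w: "word_mod n w" "spaced_word w"
  shows "inj_on (\<lambda>c. (c + (b + gadget w j (int c))) mod n) {..<n}"
proof (rule inj_on_shift)
  have "gadget w j x = gadget w j y" if "[x = y] (mod int n)" for x y
  proof -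
    have "[x - 1 = y - 1] (mod int n)" "[x - 2 = y - 2] (mod int n)"
      using that by (simp_all add: cong_iff_dvd_diff)
    then have "w (x - 1) = w (y - 1)" "w (x - 2) = w (y - 2)" "w x = w y"
      using that word_modD[OF w(1)] by blast+
    then show ?thesis by (simp add: gadget_def)
  qed
  then show "word_mod n (gadget w j)" by (simp add: word_mod_def)
  have s: "w y \<noteq> 2 \<Longrightarrow> w (y + 1) = 2" "w y \<noteq> 2 \<Longrightarrow> w (y + 2) \<noteq> w y"
    "w y = 2 \<Longrightarrow> w (y + 1) = 2 \<Longrightarrow> w (y + 2) \<noteq> 2" for y
    using w(2) by (auto simp: spaced_word_def)
  have "gadget w j x \<noteq> gadget w j (x + 1) + 1" for x
  proof -
    have e: "x + 1 - 1 = x" "x + 1 - 2 = x - 1" by auto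
    show ?thesis unfolding gadget_def e using s(1)[of x] s(2)[of "x - 1"] by (auto split: if_splits)
  qed
  moreover have "gadget w j x \<noteq> gadget w j (x + 2) + 2" for x
  proof -
    have e: "x + 2 - 1 = x + 1" "x + 2 - 2 = x" by auto
    show ?thesis unfolding gadget_def e using s(1)[of x] by (auto split: if_splits)
  qed
  moreover have "gadget w j x \<noteq> gadget w j (x + 3) + 3" for x
  proof -
    have e: "x + 3 - 1 = x + 2" "x + 3 - 2 = x + 1" by auto
    have "w (x + 2) \<noteq> 2 \<Longrightarrow> w (x + 3) = 2" using s(1)[of "x + 2"] by (simp add: add.assoc)
    then show ?thesis unfolding gadget_def e using s[of x] s(1)[of "x + 1"] by (auto split: if_splits)
  qed
  ultimately show "gadget w j x \<noteq> gadget w j (x + int d) + d" if "d \<in> {1, 2, 3}" for x d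
    using that by auto
qed (auto simp: gadget_def)

lemma gadget_inj_col:
  assumes w: "spaced_word w"
  shows "inj_on (\<lambda>j. gadget w j x) {..<3}"
proof -
  have s: "w y < 3" "w y \<noteq> 2 \<Longrightarrow> w (y + 1) = 2 \<and> w (y + 2) \<noteq> w y"
    "\<not> (w y = 2 \<and> w (y + 1) = 2 \<and> w (y + 2) = 2)" for y
    using w by (auto simp: spaced_word_def)
  have e: "x - 2 + 1 = x - 1" "x - 2 + 2 = x" "x - 1 + 1 = x" by auto
  from s(1)[of x] s(1)[of "x - 1"] s(1)[of "x - 2"] show ?thesis
    using s(2)[of "x - 1"] s(2)[of "x - 2"] s(3)[of "x - 2"]
    unfolding lessThan_3 gadget_def e
    by (elim less_3_cases) (simp_all add: inj_on_def)
qed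

subsection \<open>Words for the bands\<close>

text \<open>For four distinct points of the cycle of columns this says that the chords from
  \<open>a\<close> to \<open>b\<close> and from \<open>y\<close> to \<open>z\<close> cross.\<close>

definition separates :: "int \<Rightarrow> int \<Rightarrow> int \<Rightarrow> int \<Rightarrow> bool" where
  "separates a b y z \<longleftrightarrow> (min a b < y \<and> y < max a b) \<noteq> (min a b < z \<and> z < max a b)"
text \<open>In every cyclic arrangement of two triples, some two opposite points among the six come
  from different triples and cut the rest into two mixed pairs. The nine disjuncts run over all
  choices of such a chord.\<close>

lemma separates_six:
  assumes "distinct [x, y, z, x', y', z']"
  shows "\<exists>a b c a' b' c'. {a, b, c} = {x, y, z} \<and> {a', b', c'} = {x', y', z'} \<and>
    separates a a' b c \<and> separates a a' b' c'"
proof -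
  have "(separates x x' y z \<and> separates x x' y' z') \<or> (separates x y' y z \<and> separates x y' x' z') \<or>
    (separates x z' y z \<and> separates x z' x' y') \<or>
    (separates y x' x z \<and> separates y x' y' z') \<or> (separates y y' x z \<and> separates y y' x' z') \<or>
    (separates y z' x z \<and> separates y z' x' y') \<or>
    (separates z x' x y \<and> separates z x' y' z') \<or> (separates z y' x y \<and> separates z y' x' z') \<or>
    (separates z z' x y \<and> separates z z' x' y')"
    using assms unfolding separates_def min_def max_def by (smt (z3) distinct_length_2_or_more)
  moreover have "{y,x,z} = {x,y,z}" "{z,x,y} = {x,y,z}" "{y',x',z'} = {x',y',z'}" "{z',x',y'} = {x',y',z'}" by auto
  ultimately show ?thesis by metis
qed

text \<open>The chord from \<open>a\<close> to the middle one of the other points, in cyclic order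
  from \<open>a\<close>, separates the remaining two.\<close>

lemma separates_three:
  assumes "distinct [a, x, y, z]"
  shows "separates a x y z \<or> separates a y x z \<or> separates a z x y"
  using assms unfolding separates_def min_def max_def by (simp split: if_splits) linarith

text \<open>The letter \<open>0\<close> cuts the cycle at \<open>p\<close> and \<open>q\<close>. On
  each of the two arcs the letters \<open>1\<close> and \<open>2\<close> alternate with the parity
  of the column, with independent phases \<open>\<phi>\<close> and \<open>\<psi>\<close>.\<close>

definition cut_word :: "nat \<Rightarrow> int \<Rightarrow> int \<Rightarrow> bool \<Rightarrow> bool \<Rightarrow> int \<Rightarrow> nat" where
  "cut_word n p q \<phi> \<psi> x = (let c = x mod int n in
     if c = p \<or> c = q then 0
     else if p < c \<and> c < q then (if even c = \<phi> then 1 else 2)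
     else (if even c = \<psi> then 1 else 2))"

lemma word_mod_cut_word: "word_mod n (cut_word n p q \<phi> \<psi>)"
  by (simp add: word_mod_def cut_word_def cong_def)

text \<open>As \<open>n\<close> is even, alternation by parity survives the step from
  \<open>n - 1\<close> to \<open>0\<close>. The conditions on \<open>p\<close> and \<open>q\<close>
  keep the two zeros from being cyclically adjacent.\<close>

lemma proper_cut_word:
  assumes n: "even n" and pq: "p + 2 \<le> q" "0 \<le> p" "q < int n" "0 < p \<or> q < int n - 1"
  shows "proper_word (cut_word n p q \<phi> \<psi>)"
proof -
  have "cut_word n p q \<phi> \<psi> (x + 1) \<noteq> cut_word n p q \<phi> \<psi> x" for x
  proof -
    define c where "c = x mod int n"
    have c: "0 \<le> c" "c < int n" using pq by (auto simp: c_def)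
    show ?thesis
    proof (cases "c = int n - 1")
      case True
      have "(x + 1) mod int n = (c + 1) mod int n" by (simp add: c_def mod_add_left_eq)
      then have "(x + 1) mod int n = 0" using True by simp
      moreover have "odd c" using True n by simp
      ultimately show ?thesis using pq True c by (auto simp: cut_word_def Let_def c_def[symmetric])
    next
      case False
      have "(x + 1) mod int n = (c + 1) mod int n" by (simp add: c_def mod_add_left_eq)
      then have "(x + 1) mod int n = c + 1" using False c by simp
      then show ?thesis using pq c by (auto simp: cut_word_def Let_def c_def[symmetric])
    qed
  qed
  moreover have "cut_word n p q \<phi> \<psi> x < 3" for x by (simp add: cut_word_def Let_def)
  ultimately show ?thesis by (simp add: proper_word_def)
qed

text \<open>Since \<open>y\<close> and \<open>z\<close> lie on different arcs between
  \<open>a\<close> and \<open>b\<close>, the phases of the two arcs can be chosen to give them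
  different letters.\<close>

lemma ex_separating_word:
  assumes n: "even n" and bd: "{a, b, y, z} \<subseteq> {0..<int n}" and d: "distinct [a, b, y, z]"
    and s: "separates a b y z"
  obtains w where "word_mod n w" "proper_word w" "\<forall>x\<in>{0..<int n}. w x = 0 \<longleftrightarrow> x = a \<or> x = b"
    "w y \<noteq> w z"
proof -
  have *: thesis if bd: "{a, b, y, z} \<subseteq> {0..<int n}" and d: "distinct [a, b, y, z]"
    and s: "min a b < y" "y < max a b" "\<not> (min a b < z \<and> z < max a b)"
    and w: "\<And>w. word_mod n w \<Longrightarrow> proper_word w \<Longrightarrow> \<forall>x\<in>{0..<int n}. w x = 0 \<longleftrightarrow> x = a \<or> x = b \<Longrightarrow>
    w y \<noteq> w z \<Longrightarrow> thesis" for y z thesis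
  proof (rule w)
    let ?p = "min a b" and ?q = "max a b"
    \<comment> \<open>These phases give \<open>y\<close>, inside the arc, the letter
      \<open>1\<close> and \<open>z\<close>, outside, the letter \<open>2\<close>.\<close>
    let ?w = "cut_word n ?p ?q (even y) (odd z)"
    show "word_mod n ?w" by (rule word_mod_cut_word)
    show "proper_word ?w" by (rule proper_cut_word[OF n]) (use bd d s in \<open>auto simp: min_def max_def split: if_splits\<close>)
    show "\<forall>x\<in>{0..<int n}. ?w x = 0 \<longleftrightarrow> x = a \<or> x = b"
      by (auto simp: cut_word_def Let_def min_def max_def)
    have "?w y = 1" using bd d s by (auto simp: cut_word_def Let_def)
    moreover have "?w z = 2" using bd d s by (auto simp: cut_word_def Let_def min_def max_def)
    ultimately show "?w y \<noteq> ?w z" by simp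
  qed
  show thesis
  proof (cases "min a b < y \<and> y < max a b")
    case True
    then show thesis using *[of y z thesis] bd d s that unfolding separates_def by auto
  next
    case False
    then have "min a b < z" "z < max a b" using s unfolding separates_def by auto
    then show thesis using *[of z y thesis] bd d False that by (auto simp: insert_commute)
  qed
qed

text \<open>For an anchored band with assigned columns \<open>t\<close>, the column \<open>x\<close>
  opposite the anchor \<open>a\<close> becomes the private zero, and the other two columns receive
  \<open>1\<close> and \<open>2\<close>.\<close>

lemma ex_anchored_word:
  assumes n: "even n" and t: "inj_on t {..<3::nat}" "t ` {..<3} \<subseteq> {0..<int n}"
    and a: "a \<in> {0..<int n} - t ` {..<3}"
  obtains w x where "word_mod n w" "proper_word w" "x \<in> t ` {..<3}" "inj_on (w \<circ> t) {..<3}"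
    "\<forall>c\<in>{0..<int n}. w c = 0 \<longleftrightarrow> c = a \<or> c = x"
proof -
  note main = that
  have d: "distinct [a, t 0, t 1, t 2]" and bd: "{a, t 0, t 1, t 2} \<subseteq> {0..<int n}"
    using t a unfolding lessThan_3 by (auto simp: inj_on_def)
  have *: thesis if e: "{x, y, z} = {t 0, t 1, t 2}" and dd: "distinct [a, x, y, z]"
    and ss: "separates a x y z" for x y z
  proof -
    have bd': "{a, x, y, z} \<subseteq> {0..<int n}" using e bd by auto
    obtain w where w: "word_mod n w" "proper_word w"
        "\<forall>c\<in>{0..<int n}. w c = 0 \<longleftrightarrow> c = a \<or> c = x" "w y \<noteq> w z"
      using ex_separating_word[OF n bd' dd ss] .
    have "w x = 0" "w y \<noteq> 0" "w z \<noteq> 0"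
      using w(3)[rule_format, of x] w(3)[rule_format, of y] w(3)[rule_format, of z] dd bd' by simp_all
    then have "inj_on w {x, y, z}" using w(4) unfolding inj_on_def by force
    then have "inj_on w (t ` {..<3})" unfolding lessThan_3 by (simp add: e)
    then have "inj_on (w \<circ> t) {..<3}" using t(1) by (rule comp_inj_on[rotated])
    moreover have "x \<in> t ` {..<3}" using e unfolding lessThan_3 by auto
    moreover have "\<forall>c\<in>{0..<int n}. w c = 0 \<longleftrightarrow> c = a \<or> c = x" by (rule w(3))
    ultimately show thesis by (intro main[OF w(1,2)])
  qed
  have perm: "{t 1, t 0, t 2} = {t 0, t 1, t 2}" "{t 2, t 0, t 1} = {t 0, t 1, t 2}" by auto
  have "distinct [a, t 1, t 0, t 2]" "distinct [a, t 2, t 0, t 1]" using d by auto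
  then show thesis
    using separates_three[OF d] *[OF refl d] *[OF perm(1)] *[OF perm(2)] by blast
qed

lemma ex_mutually_anchored_words:
  assumes n: "even n" and t: "inj_on t {..<3::nat}" "t ` {..<3} \<subseteq> {0..<int n}"
    and t': "inj_on t' {..<3::nat}" "t' ` {..<3} \<subseteq> {0..<int n}"
    and disj: "t ` {..<3} \<inter> t' ` {..<3} = {}"
  obtains w w' a b where "word_mod n w" "proper_word w" "word_mod n w'" "proper_word w'"
    "a \<in> t ` {..<3}" "b \<in> t' ` {..<3}" "inj_on (w \<circ> t) {..<3}" "inj_on (w' \<circ> t') {..<3}"
    "\<forall>c\<in>{0..<int n}. w c = 0 \<longleftrightarrow> c = a \<or> c = b"
    "\<forall>c\<in>{0..<int n}. w' c = 0 \<longleftrightarrow> c = a \<or> c = b"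
proof -
  have d: "distinct [t 0, t 1, t 2, t' 0, t' 1, t' 2]"
    using t(1) t'(1) disj unfolding lessThan_3 by (auto simp: inj_on_def)
  obtain a b c a' b' c' where e: "{a, b, c} = {t 0, t 1, t 2}" and e': "{a', b', c'} = {t' 0, t' 1, t' 2}"
    and s: "separates a a' b c" "separates a a' b' c'"
    using separates_six[OF d] by metis
  have e3: "{a, b, c} = t ` {..<3}" and e3': "{a', b', c'} = t' ` {..<3}"
    unfolding lessThan_3 using e e' by auto
  have "card {a, b, c} = 3" "card {a', b', c'} = 3" unfolding e e' using d by auto
  then have dd: "distinct [a, b, c]" "distinct [a', b', c']"
    by (auto simp: card_insert_if split: if_splits)
  have nin: "{a, b, c} \<inter> {a', b', c'} = {}" using disj unfolding e3 e3' .
  have bd: "{a, b, c} \<subseteq> {0..<int n}" "{a', b', c'} \<subseteq> {0..<int n}" unfolding e3 e3' by fact+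
  have p: "{a, a', b, c} \<subseteq> {0..<int n}" "distinct [a, a', b, c]"
    and p': "{a, a', b', c'} \<subseteq> {0..<int n}" "distinct [a, a', b', c']"
    using bd dd nin by auto
  obtain w where w: "word_mod n w" "proper_word w"
        "\<forall>c\<in>{0..<int n}. w c = 0 \<longleftrightarrow> c = a \<or> c = a'" "w b \<noteq> w c"
    using ex_separating_word[OF n p s(1)] .
  obtain w' where w': "word_mod n w'" "proper_word w'"
        "\<forall>c\<in>{0..<int n}. w' c = 0 \<longleftrightarrow> c = a \<or> c = a'" "w' b' \<noteq> w' c'"
    using ex_separating_word[OF n p' s(2)] .
  have "w a = 0" "w b \<noteq> 0" "w c \<noteq> 0"
    using w(3)[rule_format, of a] w(3)[rule_format, of b] w(3)[rule_format, of c] p by simp_all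
  then have "inj_on w {a, b, c}" using w(4) unfolding inj_on_def by force
  then have i: "inj_on (w \<circ> t) {..<3}" unfolding e3 using t(1) by (rule comp_inj_on[rotated])
  have "w' a' = 0" "w' b' \<noteq> 0" "w' c' \<noteq> 0"
    using w'(3)[rule_format, of a'] w'(3)[rule_format, of b'] w'(3)[rule_format, of c'] p' by simp_all
  then have "inj_on w' {a', b', c'}" using w'(4) unfolding inj_on_def by force
  then have i': "inj_on (w' \<circ> t') {..<3}" unfolding e3' using t'(1) by (rule comp_inj_on[rotated])
  have a: "a \<in> t ` {..<3}" and a': "a' \<in> t' ` {..<3}" using e3 e3' by auto
  have z: "\<forall>c\<in>{0..<int n}. w c = 0 \<longleftrightarrow> c = a \<or> c = a'" by (rule w(3))
  have z': "\<forall>c\<in>{0..<int n}. w' c = 0 \<longleftrightarrow> c = a \<or> c = a'" by (rule w'(3))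
  show thesis by (rule that[OF w(1,2) w'(1,2) a a' i i' z z'])
qed

subsection \<open>Words for the gadgets\<close>

text \<open>A state is a pair of consecutive letters of a spaced word.\<close>

definition spaced_states :: "(nat \<times> nat) set" where
  "spaced_states = {(0, 2), (1, 2), (2, 0), (2, 1), (2, 2)}"

definition spaced_step :: "((nat \<times> nat) \<times> (nat \<times> nat)) set" where
  "spaced_step = {((0, 2), (2, 2)), ((0, 2), (2, 1)), ((1, 2), (2, 2)), ((1, 2), (2, 0)),
     ((2, 0), (0, 2)), ((2, 1), (1, 2)), ((2, 2), (2, 0)), ((2, 2), (2, 1))}"

text \<open>The first components along a closed walk of length \<open>n\<close> form a spaced word,
  since each step overlaps two states in one letter. The offset \<open>s\<close> lets the walk start
  at any column.\<close>

lemma spaced_word_of_cycle: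
  assumes f: "\<And>i. i < n \<Longrightarrow> (f i, f (Suc i)) \<in> spaced_step" and cyc: "f n = f 0" and n: "n > 0"
    and w: "w = (\<lambda>x. fst (f (nat ((x - s) mod int n))))"
  shows "word_mod n w" "spaced_word w"
proof -
  show "word_mod n w"
    unfolding word_mod_def w
  proof (intro allI impI)
    fix x y assume "[x = y] (mod int n)"
    then have "[x - s = y - s] (mod int n)" by (simp add: cong_iff_dvd_diff)
    then show "fst (f (nat ((x - s) mod int n))) = fst (f (nat ((y - s) mod int n)))"
      by (simp add: cong_def)
  qed
  define h where "h x = f (nat (x mod int n))" for x
  have h: "(h x, h (x + 1)) \<in> spaced_step" for x
  proof -
    define c where "c = nat (x mod int n)"
    have c: "c < n" "int c = x mod int n" using n by (auto simp: c_def nat_less_iff)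
    have hx: "h x = f c" by (simp add: h_def c_def)
    have 1: "(x + 1) mod int n = (int c + 1) mod int n" by (simp add: c mod_add_left_eq)
    have 2: "f (nat ((int c + 1) mod int n)) = f (Suc c)"
    proof (cases "Suc c = n")
      case True
      then have "int c + 1 = int n" by simp
      then have "(int c + 1) mod int n = 0" by simp
      then show ?thesis using True cyc by simp
    next
      case False
      then have "int c + 1 < int n" using c by simp
      then have "(int c + 1) mod int n = int (Suc c)" by simp
      then show ?thesis by (simp only: nat_int)
    qed
    have "h (x + 1) = f (Suc c)" unfolding h_def 1 2 ..
    then show ?thesis using f[OF c(1)] unfolding hx by (simp only:)
  qed
  have w': "w x = fst (h (x - s))" for x by (simp add: w h_def)
  have snd: "snd (h x) = fst (h (x + 1))" for x
    using h[of x] by (auto simp: spaced_step_def)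
  have "w x < 3 \<and> (w x \<noteq> 2 \<longrightarrow> w (x + 1) = 2 \<and> w (x + 2) \<noteq> w x) \<and>
     \<not> (w x = 2 \<and> w (x + 1) = 2 \<and> w (x + 2) = 2)" for x
  proof -
    have e: "x + 1 - s = x - s + 1" "x + 2 - s = x - s + 1 + 1" by auto
    have w1: "w (x + 1) = snd (h (x - s))" and w2: "w (x + 2) = snd (h (x - s + 1))"
      unfolding w' snd e by (rule refl)+
    have w0: "w x = fst (h (x - s))" by (rule w')
    show ?thesis unfolding w1 w2 w0 using h[of "x - s"] by (auto simp: spaced_step_def)
  qed
  then show "spaced_word w" by (simp add: spaced_word_def)
qed

section \<open>Walks of prescribed length between states\<close>

definition spaced_next :: "nat \<times> nat \<Rightarrow> (nat \<times> nat) list" where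
  "spaced_next s = (if snd s \<noteq> 2 then [(snd s, 2)]
     else if fst s = 2 then [(2, 0), (2, 1)] else [(2, 2), (2, 1 - fst s)])"

text \<open>An executable list of the ends of walks of length \<open>d\<close>, so that short
  lengths can be settled by evaluation.\<close>

fun spaced_reach :: "nat \<Rightarrow> nat \<times> nat \<Rightarrow> (nat \<times> nat) list" where
  "spaced_reach 0 s = [s]"
| "spaced_reach (Suc d) s = remdups (concat (map spaced_next (spaced_reach d s)))"

lemma spaced_reach:
  assumes "s \<in> spaced_states" "t \<in> set (spaced_reach d s)"
  shows "(s, t) \<in> spaced_step ^^ d"
proof -
  have "\<forall>t \<in> set (spaced_reach d s). t \<in> spaced_states \<and> (s, t) \<in> spaced_step ^^ d"
  proof (induction d)
    case 0 then show ?case using assms(1) by simp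
  next
    case (Suc d)
    have *: "\<forall>t \<in> spaced_states. \<forall>u \<in> set (spaced_next t). u \<in> spaced_states \<and> (t, u) \<in> spaced_step"
      unfolding spaced_states_def spaced_step_def by code_simp
    show ?case
    proof
      fix u assume "u \<in> set (spaced_reach (Suc d) s)"
      then obtain t where t: "t \<in> set (spaced_reach d s)" "u \<in> set (spaced_next t)" by auto
      have st: "t \<in> spaced_states" "(s, t) \<in> spaced_step ^^ d" using Suc t(1) by blast+
      from * st(1) t(2) have "u \<in> spaced_states" "(t, u) \<in> spaced_step" by blast+
      then show "u \<in> spaced_states \<and> (s, u) \<in> spaced_step ^^ Suc d"
        using relpow_Suc_I[OF st(2)] by blast
    qed
  qed
  then show ?thesis using assms(2) by blast
qed

lemma spaced_step_power_6: "spaced_states \<times> spaced_states \<subseteq> spaced_step ^^ 6"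
proof -
  have "\<forall>s \<in> spaced_states. \<forall>t \<in> spaced_states. t \<in> set (spaced_reach 6 s)"
    unfolding spaced_states_def by code_simp
  then show ?thesis using spaced_reach by blast
qed

text \<open>Every state has a predecessor among the states, so universal reachability in exactly
  \<open>6\<close> steps passes on to all greater lengths.\<close>

lemma spaced_step_power:
  assumes "6 \<le> d"
  shows "spaced_states \<times> spaced_states \<subseteq> spaced_step ^^ d"
  using assms
proof (induction d rule: dec_induct)
  case (step d)
  have 1: "\<exists>b\<in>spaced_states. (b, c) \<in> spaced_step" if "c \<in> spaced_states" for c
    using that by (auto simp: spaced_states_def spaced_step_def)
  show ?case
  proof
    fix x assume "x \<in> spaced_states \<times> spaced_states"
    then obtain a c where x: "x = (a, c)" "a \<in> spaced_states" "c \<in> spaced_states" by blast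
    then obtain b where "b \<in> spaced_states" "(b, c) \<in> spaced_step" using 1 by blast
    then show "x \<in> spaced_step ^^ Suc d"
      using step.IH x relpow_Suc_I[of a b d spaced_step c] by blast
  qed
qed (rule spaced_step_power_6)

text \<open>The letters \<open>0\<close> and \<open>1\<close> cannot stand at distance
  \<open>1\<close> or \<open>4\<close>. For these gaps the target is therefore
  \<open>(2, 0)\<close>, whose letter is \<open>2\<close>; all other cases aim at the letter
  \<open>0\<close> of \<open>(0, 2)\<close>.\<close>

lemma spaced_step_to:
  assumes "1 \<le> d" "t \<in> {(0, 2), (2, 0)}"
    "t = (0, 2) \<and> (i = 2 \<or> i = 1 \<and> d \<noteq> 1 \<and> d \<noteq> 4) \<or> t = (2, 0) \<and> i = 1 \<and> (d = 1 \<or> d = 4)"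
  obtains s where "s \<in> spaced_states" "fst s = i" "(s, t) \<in> spaced_step ^^ d"
proof (cases "6 \<le> d")
  case True
  moreover have "t \<in> spaced_states" "(2, 0) \<in> spaced_states" "(1, 2) \<in> spaced_states"
    using assms(2) by (auto simp: spaced_states_def)
  moreover have "i = 1 \<or> i = 2" using assms(3) by auto
  ultimately show thesis using spaced_step_power[OF True] that by fastforce
next
  case False
  have "\<forall>d \<in> {1, 2, 3, 4, 5}. (\<exists>s \<in> spaced_states. fst s = 2 \<and> (0, 2) \<in> set (spaced_reach d s)) \<and>
    (d \<noteq> 1 \<longrightarrow> d \<noteq> 4 \<longrightarrow> (\<exists>s \<in> spaced_states. fst s = 1 \<and> (0, 2) \<in> set (spaced_reach d s))) \<and>
    (d = 1 \<or> d = 4 \<longrightarrow> (\<exists>s \<in> spaced_states. fst s = 1 \<and> (2, 0) \<in> set (spaced_reach d s)))"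
    unfolding spaced_states_def by code_simp
  moreover have "d \<in> {1, 2, 3, 4, 5}" using False assms(1) by auto
  ultimately have "\<exists>s \<in> spaced_states. fst s = i \<and> t \<in> set (spaced_reach d s)"
    using assms(3) by blast
  then show thesis using spaced_reach that by blast
qed

lemma spaced_step_from:
  assumes "1 \<le> d"
    "t = (0, 2) \<and> (i = 2 \<or> i = 1 \<and> d \<noteq> 1 \<and> d \<noteq> 4) \<or> t = (2, 0) \<and> i = 0 \<and> (d = 1 \<or> d = 4)"
  obtains s where "s \<in> spaced_states" "fst s = i" "(t, s) \<in> spaced_step ^^ d"
proof (cases "6 \<le> d")
  case True
  moreover have "t \<in> spaced_states" "(2, 0) \<in> spaced_states" "(1, 2) \<in> spaced_states"
    using assms(2) by (auto simp: spaced_states_def)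
  moreover have "i = 1 \<or> i = 2" using assms(2) True by auto
  ultimately show thesis using spaced_step_power[OF True] that by fastforce
next
  case False
  have "\<forall>d \<in> {1, 2, 3, 4, 5}. (\<exists>s \<in> spaced_states. fst s = 2 \<and> s \<in> set (spaced_reach d (0, 2))) \<and>
    (d \<noteq> 1 \<longrightarrow> d \<noteq> 4 \<longrightarrow> (\<exists>s \<in> spaced_states. fst s = 1 \<and> s \<in> set (spaced_reach d (0, 2)))) \<and>
    (d = 1 \<or> d = 4 \<longrightarrow> (\<exists>s \<in> spaced_states. fst s = 0 \<and> s \<in> set (spaced_reach d (2, 0))))"
    unfolding spaced_states_def by code_simp
  moreover have "d \<in> {1, 2, 3, 4, 5}" using False assms(1) by auto
  ultimately have "\<exists>s \<in> spaced_states. fst s = i \<and> s \<in> set (spaced_reach d t)"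
    using assms(2) by blast
  moreover have "t \<in> spaced_states" using assms(2) by (auto simp: spaced_states_def)
  ultimately show thesis using spaced_reach that by blast
qed

text \<open>The three letters read \<open>1 0 2\<close> or \<open>2 0 1\<close> if some gap admits
  both \<open>0\<close> and \<open>1\<close>. When both gaps are \<open>1\<close> or
  \<open>4\<close>, they read \<open>1 2 0\<close>.\<close>

lemma spaced_step_gaps:
  assumes "1 \<le> g" "1 \<le> h"
  obtains s t u where "s \<in> spaced_states" "u \<in> spaced_states" "(s, t) \<in> spaced_step ^^ g"
    "(t, u) \<in> spaced_step ^^ h" "distinct [fst s, fst t, fst u]"
proof -
  consider "g \<noteq> 1" "g \<noteq> 4" | "h \<noteq> 1" "h \<noteq> 4" | "g = 1 \<or> g = 4" "h = 1 \<or> h = 4" by blast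
  then show thesis
  proof cases
    case 1
    obtain s where "s \<in> spaced_states" "fst s = 1" "(s, (0, 2)) \<in> spaced_step ^^ g"
      using spaced_step_to[OF assms(1), of "(0, 2)" 1] 1 by auto
    moreover obtain u where "u \<in> spaced_states" "fst u = 2" "((0, 2), u) \<in> spaced_step ^^ h"
      using spaced_step_from[OF assms(2), of "(0, 2)" 2] by auto
    ultimately show thesis using that[of s u "(0, 2)"] by simp
  next
    case 2
    obtain s where "s \<in> spaced_states" "fst s = 2" "(s, (0, 2)) \<in> spaced_step ^^ g"
      using spaced_step_to[OF assms(1), of "(0, 2)" 2] by auto
    moreover obtain u where "u \<in> spaced_states" "fst u = 1" "((0, 2), u) \<in> spaced_step ^^ h"
      using spaced_step_from[OF assms(2), of "(0, 2)" 1] 2 by auto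
    ultimately show thesis using that[of s u "(0, 2)"] by simp
  next
    case 3
    obtain s where "s \<in> spaced_states" "fst s = 1" "(s, (2, 0)) \<in> spaced_step ^^ g"
      using spaced_step_to[OF assms(1), of "(2, 0)" 1] 3 by auto
    moreover obtain u where "u \<in> spaced_states" "fst u = 0" "((2, 0), u) \<in> spaced_step ^^ h"
      using spaced_step_from[OF assms(2), of "(2, 0)" 0] 3 by auto
    ultimately show thesis using that[of s u "(2, 0)"] by simp
  qed
qed

text \<open>After walks through the two given gaps, the remaining arc has length at least
  \<open>6\<close>, enough to return from any state to any other.\<close>

lemma ex_spaced_word_gaps:
  assumes "1 \<le> g" "1 \<le> h" "g + h + 6 \<le> n"
  obtains w where "word_mod n w" "spaced_word w"
    "distinct [w x, w (x + int g), w (x + int (g + h))]"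
proof -
  obtain s t u where stu: "s \<in> spaced_states" "u \<in> spaced_states" "(s, t) \<in> spaced_step ^^ g"
    "(t, u) \<in> spaced_step ^^ h" "distinct [fst s, fst t, fst u]"
    using spaced_step_gaps[OF assms(1,2)] .
  define k where "k = n - (g + h)"
  have k: "n = g + h + k" "6 \<le> k" using assms(3) by (auto simp: k_def)
  have us: "(u, s) \<in> spaced_step ^^ k" using spaced_step_power[OF k(2)] stu(1,2) by (meson SigmaI subsetD)
  obtain f1 where f1: "f1 0 = s" "f1 g = t" "\<And>i. i < g \<Longrightarrow> (f1 i, f1 (Suc i)) \<in> spaced_step"
    using stu(3) unfolding relpow_fun_conv by blast
  obtain f2 where f2: "f2 0 = t" "f2 h = u" "\<And>i. i < h \<Longrightarrow> (f2 i, f2 (Suc i)) \<in> spaced_step"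
    using stu(4) unfolding relpow_fun_conv by blast
  obtain f3 where f3: "f3 0 = u" "f3 k = s" "\<And>i. i < k \<Longrightarrow> (f3 i, f3 (Suc i)) \<in> spaced_step"
    using us unfolding relpow_fun_conv by blast
  \<comment> \<open>The closed walk runs from \<open>s\<close> to \<open>t\<close>, then to
    \<open>u\<close>, and back to \<open>s\<close>.\<close>
  define f where "f i = (if i \<le> g then f1 i else if i \<le> g + h then f2 (i - g) else f3 (i - (g + h)))" for i
  have step: "(f i, f (Suc i)) \<in> spaced_step" if "i < n" for i
  proof -
    consider "i < g" | "i = g" | "g < i" "i < g + h" | "i = g + h" | "g + h < i" by linarith
    then show ?thesis
    proof cases
      case 1 then show ?thesis using f1(3)[of i] by (simp add: f_def)
    next
      case 2 then show ?thesis using f2(3)[of 0] f2(1) f1(2) assms by (simp add: f_def)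
    next
      case 3 then show ?thesis using f2(3)[of "i - g"] by (simp add: f_def Suc_diff_le)
    next
      case 4 then show ?thesis using f3(3)[of 0] f3(1) f2(2) assms k by (simp add: f_def)
    next
      case 5 then show ?thesis using f3(3)[of "i - (g + h)"] that k by (simp add: f_def Suc_diff_le)
    qed
  qed
  have cyc: "f n = f 0" using k f1(1) f3(2) by (simp add: f_def)
  have n: "n > 0" using k by simp
  define w where "w = (\<lambda>y. fst (f (nat ((y - x) mod int n))))"
  note w = spaced_word_of_cycle[OF step cyc n w_def]
  have "w (x + int i) = fst (f i)" if "i < n" for i
    using that by (simp add: w_def)
  from this[of 0] this[of g] this[of "g + h"] have
    "w x = fst s" "w (x + int g) = fst t" "w (x + int (g + h)) = fst u"
    using k f1 f2 by (auto simp: f_def)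
  then have "distinct [w x, w (x + int g), w (x + int (g + h))]" using stu(5) by simp
  then show thesis using that w by blast
qed

lemma ex_spaced_word:
  assumes t: "inj_on t {..<3::nat}" "t ` {..<3} \<subseteq> {0..<int n}" and n: "16 \<le> n"
  obtains w where "word_mod n w" "spaced_word w" "inj_on (w \<circ> t) {..<3}"
proof -
  note main = that
  have *: thesis if xyz: "{x, y, z} = t ` {..<3}" "x < y" "y < z" for x y z
  proof -
    have "{x, y, z} \<subseteq> {0..<int n}" using t(2) unfolding xyz(1) .
    then have bd: "0 \<le> x" "z < int n" by auto
    define g where "g = nat (y - x)"
    have g: "y = x + int g" "1 \<le> g" using xyz(2) by (auto simp: g_def)
    define h where "h = nat (z - y)"
    have h: "z = y + int h" "1 \<le> h" using xyz(3) by (auto simp: h_def)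
    have gh: "g + h < n" using bd g h by linarith
    have "\<exists>w. word_mod n w \<and> spaced_word w \<and> distinct [w x, w y, w z]"
    proof -
      \<comment> \<open>The three cyclic gaps sum to \<open>n\<close>, which exceeds
        \<open>3 * 5\<close>, so one of them is at least \<open>6\<close>. It is rotated into the
        place of the closing arc.\<close>
      consider "g + h + 6 \<le> n" | "6 \<le> g" | "6 \<le> h" using n by linarith
      then show ?thesis
      proof cases
        case 1
        then obtain w where w: "word_mod n w" "spaced_word w"
          "distinct [w x, w (x + int g), w (x + int (g + h))]"
          using ex_spaced_word_gaps[OF g(2) h(2), of n x] by blast
        then show ?thesis using g h by (intro exI[of _ w]) (simp add: add.assoc)
      next
        case 2
        define k where "k = n - (g + h)"
        have kk: "1 \<le> k" "h + k + 6 \<le> n" using 2 gh by (auto simp: k_def)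
        obtain w where w: "word_mod n w" "spaced_word w"
          "distinct [w y, w (y + int h), w (y + int (h + k))]"
          using ex_spaced_word_gaps[OF h(2) kk, of y] by blast
        have "[y + int (h + k) = x] (mod int n)" using gh g by (simp add: k_def cong_iff_dvd_diff)
        then have "w (y + int (h + k)) = w x" using w(1) word_modD by blast
        then show ?thesis using w h by (intro exI[of _ w]) auto
      next
        case 3
        define k where "k = n - (g + h)"
        have kk: "1 \<le> k" "k + g + 6 \<le> n" using 3 gh by (auto simp: k_def)
        obtain w where w: "word_mod n w" "spaced_word w"
          "distinct [w z, w (z + int k), w (z + int (k + g))]"
          using ex_spaced_word_gaps[OF kk(1) g(2) kk(2), of z] by blast
        have "[z + int k = x] (mod int n)" "[z + int (k + g) = y] (mod int n)"
          using gh g h by (simp_all add: k_def cong_iff_dvd_diff)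
        then have "w (z + int k) = w x" "w (z + int (k + g)) = w y" using w(1) word_modD by blast+
        then show ?thesis using w by (intro exI[of _ w]) auto
      qed
    qed
    then obtain w where w: "word_mod n w" "spaced_word w" "distinct [w x, w y, w z]" by blast
    then have "inj_on w (t ` {..<3})" unfolding xyz(1)[symmetric] by (auto simp: inj_on_def)
    then have "inj_on (w \<circ> t) {..<3}" using t(1) by (rule comp_inj_on[rotated])
    then show thesis using main w by blast
  qed
  have d: "t 0 \<noteq> t 1" "t 0 \<noteq> t 2" "t 1 \<noteq> t 2" using t(1) unfolding lessThan_3 by (auto simp: inj_on_def)
  have "{t 0, t 1, t 2} = t ` {..<3}" unfolding lessThan_3 by auto
  note * = *[unfolded this[symmetric]]
  consider "t 0 < t 1" "t 1 < t 2" | "t 0 < t 2" "t 2 < t 1" | "t 1 < t 0" "t 0 < t 2"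
    | "t 1 < t 2" "t 2 < t 0" | "t 2 < t 0" "t 0 < t 1" | "t 2 < t 1" "t 1 < t 0"
    using d by linarith
  then show thesis
    using *[of "t 0" "t 1" "t 2"] *[of "t 0" "t 2" "t 1"] *[of "t 1" "t 0" "t 2"]
      *[of "t 1" "t 2" "t 0"] *[of "t 2" "t 0" "t 1"] *[of "t 2" "t 1" "t 0"]
    by cases (simp_all add: insert_commute)
qed

subsection \<open>The block construction\<close>

lemma transversal_sums:
  assumes T: "transversal n L T" and L: "L \<subseteq> {0..<n} \<times> {0..<n} \<times> {0..<n}"
  shows "(\<Sum>(r, c, s)\<in>T. f r) = sum f {..<n}" "(\<Sum>(r, c, s)\<in>T. f c) = sum f {..<n}"
    "(\<Sum>(r, c, s)\<in>T. f s) = sum f {..<n}"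
    "inj_on (\<lambda>(r, c, s). r) T" "inj_on (\<lambda>(r, c, s). c) T" "inj_on (\<lambda>(r, c, s). s) T" "finite T"
proof -
  have "T \<subseteq> {0..<n} \<times> {0..<n} \<times> {0..<n}" using T L by (auto simp: transversal_def)
  then show fin: "finite T" by (rule finite_subset) auto
  have *: "inj_on p T \<and> (\<Sum>e\<in>T. f (p e)) = sum f {..<n}" if "p ` T = {0..<n}" for p :: "entry \<Rightarrow> nat"
  proof -
    have "inj_on p T" using that T fin by (intro eq_card_imp_inj_on) (auto simp: transversal_def)
    then have "(\<Sum>e\<in>T. f (p e)) = sum f (p ` T)" by (simp add: sum.reindex)
    then show ?thesis using that \<open>inj_on p T\<close> by (simp add: atLeast0LessThan)
  qed
  from *[of "\<lambda>(r, c, s). r"] *[of "\<lambda>(r, c, s). c"] *[of "\<lambda>(r, c, s). s"] T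
  show "(\<Sum>(r, c, s)\<in>T. f r) = sum f {..<n}" "(\<Sum>(r, c, s)\<in>T. f c) = sum f {..<n}"
    "(\<Sum>(r, c, s)\<in>T. f s) = sum f {..<n}"
    "inj_on (\<lambda>(r, c, s). r) T" "inj_on (\<lambda>(r, c, s). c) T" "inj_on (\<lambda>(r, c, s). s) T"
    unfolding transversal_def by (simp_all add: case_prod_unfold)
qed

lemma shifted_square_subset: "n > 0 \<Longrightarrow> shifted_square n g \<subseteq> {0..<n} \<times> {0..<n} \<times> {0..<n}"
  by (auto simp: shifted_square_def)

text \<open>Columns and symbols have equal sums along \<open>T\<close>, so the values of
  \<open>g\<close> sum to \<open>0\<close> modulo \<open>n\<close>. The total deficit is then a
  multiple of \<open>n\<close> below \<open>n\<close>, hence \<open>0\<close>, and so is each of its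
  terms.\<close>

lemma transversal_attains_bound:
  assumes T: "transversal n (shifted_square n g) T" and e: "(r, c, s) \<in> T"
    and g: "\<And>r c. r < n \<Longrightarrow> c < n \<Longrightarrow> g r c \<le> v r \<and> v r \<le> g r c + d r"
    and v: "n dvd (\<Sum>r<n. v r)" and d: "(\<Sum>r<n. d r) < n"
  shows "g r c = v r"
proof -
  have "n > 0" using d by simp
  note sums = transversal_sums[OF T shifted_square_subset[OF this]]
  have sq: "r < n \<and> c < n \<and> s = (c + g r c) mod n" if "(r, c, s) \<in> T" for r c s
    using T that by (auto simp: transversal_def shifted_square_def)
  have "[s = c + g r c] (mod n)" if "(r, c, s) \<in> T" for r c s
    using sq[OF that] by (simp add: cong_def)
  then have "[(\<Sum>(r, c, s)\<in>T. s) = (\<Sum>(r, c, s)\<in>T. c + g r c)] (mod n)"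
    by (intro cong_sum) auto
  moreover have "(\<Sum>(r, c, s)\<in>T. c + g r c) = (\<Sum>(r, c, s)\<in>T. c) + (\<Sum>(r, c, s)\<in>T. g r c)"
    by (simp add: case_prod_unfold sum.distrib)
  moreover have "(\<Sum>(r, c, s)\<in>T. s) = (\<Sum>(r, c, s)\<in>T. c)" using sums(2,3)[of "\<lambda>x. x"] by simp
  ultimately have "[(\<Sum>(r, c, s)\<in>T. c) + (\<Sum>(r, c, s)\<in>T. g r c) = (\<Sum>(r, c, s)\<in>T. c) + 0] (mod n)"
    by (simp add: cong_sym_eq)
  then have gn: "n dvd (\<Sum>(r, c, s)\<in>T. g r c)"
    using cong_add_lcancel_nat cong_0_iff by blast
  have le: "(\<Sum>(r, c, s)\<in>T. v r - g r c) \<le> (\<Sum>(r, c, s)\<in>T. d r)"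
    by (rule sum_mono) (use g sq in fastforce)
  have "(\<Sum>(r, c, s)\<in>T. v r) = (\<Sum>(r, c, s)\<in>T. g r c) + (\<Sum>(r, c, s)\<in>T. v r - g r c)"
    unfolding sum.distrib[symmetric]
    by (rule sum.cong[OF refl]) (use g sq in fastforce)
  then have "n dvd (\<Sum>(r, c, s)\<in>T. g r c) + (\<Sum>(r, c, s)\<in>T. v r - g r c)"
    using v sums(1)[of v] by simp
  then have "n dvd (\<Sum>(r, c, s)\<in>T. v r - g r c)"
    using gn dvd_add_right_iff by blast
  moreover have "(\<Sum>(r, c, s)\<in>T. v r - g r c) < n" using le d sums(1)[of d] by simp
  ultimately have "(\<Sum>(r, c, s)\<in>T. v r - g r c) = 0"
    using nat_dvd_not_less by blast
  then have "v r - g r c = 0" using sums(7) e by (auto simp: sum_eq_0_iff)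
  then show ?thesis using g[of r c] sq[OF e] by simp
qed

text \<open>Blocks \<open>i < G\<close> are gadgets on the rows \<open>4 i, 4 i + 1, 4 i + 3\<close>; the row \<open>4 i + 2\<close> is left alone. Blocks
\<open>G \<le> i < N\<close> are bands on the rows from \<open>4 G + 3 (i - G)\<close>.\<close>

definition block_base :: "nat \<Rightarrow> nat \<Rightarrow> nat" where
  "block_base G i = (if i < G then 4 * i else G + 3 * i)"

definition block_row :: "nat \<Rightarrow> nat \<Rightarrow> nat \<Rightarrow> nat" where
  "block_row G i j = block_base G i + (if i < G \<and> j = 2 then 3 else j)"

definition block_top :: "nat \<Rightarrow> nat \<Rightarrow> nat" where
  "block_top G i = block_base G i + (if i < G then 3 else 2)"

definition block_val :: "nat \<Rightarrow> (nat \<Rightarrow> int \<Rightarrow> nat) \<Rightarrow> nat \<Rightarrow> nat \<Rightarrow> nat \<Rightarrow> nat" where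
  "block_val G W i j c = block_base G i + (if i < G then gadget (W i) j (int c) else band (W i) j (int c))"

text \<open>A partial inverse of \<open>block_row\<close>; \<open>None\<close> marks the rows
  outside all blocks, which keep the cyclic shift \<open>r\<close>.\<close>

definition block_index :: "nat \<Rightarrow> nat \<Rightarrow> nat \<Rightarrow> (nat \<times> nat) option" where
  "block_index G N r = (if \<exists>i<N. \<exists>j<3. r = block_row G i j
     then Some (THE (i, j). i < N \<and> j < 3 \<and> r = block_row G i j) else None)"

definition block_shift :: "nat \<Rightarrow> nat \<Rightarrow> (nat \<Rightarrow> int \<Rightarrow> nat) \<Rightarrow> nat \<Rightarrow> nat \<Rightarrow> nat" where
  "block_shift G N W r c = (case block_index G N r of None \<Rightarrow> r | Some (i, j) \<Rightarrow> block_val G W i j c)"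

definition top_shift :: "nat \<Rightarrow> nat \<Rightarrow> nat \<Rightarrow> nat" where
  "top_shift G N r = (case block_index G N r of None \<Rightarrow> r | Some (i, j) \<Rightarrow> block_top G i)"

lemma block_row_inject:
  assumes "block_row G i j = block_row G i' j'" "j < 3" "j' < 3"
  shows "i = i' \<and> j = j'"
proof (cases "i < G \<longleftrightarrow> i' < G")
  case True
  from assms(2,3) show ?thesis using assms(1) True unfolding block_row_def block_base_def
    by (elim less_3_cases) (simp_all split: if_splits, presburger+)
next
  case False
  then show ?thesis using assms unfolding block_row_def block_base_def by (auto split: if_splits)
qed

lemma block_index_row [simp]:
  assumes "i < N" "j < 3"
  shows "block_index G N (block_row G i j) = Some (i, j)"
proof -
  have "(THE (i', j'). i' < N \<and> j' < 3 \<and> block_row G i j = block_row G i' j') = (i, j)"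
  proof (rule the_equality)
    fix p :: "nat \<times> nat"
    assume p: "case p of (i', j') \<Rightarrow> i' < N \<and> j' < 3 \<and> block_row G i j = block_row G i' j'"
    obtain i' j' where ij: "p = (i', j')" by (cases p)
    then show "p = (i, j)" using p block_row_inject[of G i j i' j'] assms(2) by simp
  qed (use assms in simp)
  moreover have "\<exists>i'<N. \<exists>j'<3. block_row G i j = block_row G i' j'" using assms by blast
  ultimately show ?thesis unfolding block_index_def by simp
qed

lemma block_index_cases:
  obtains i j where "i < N" "j < 3" "r = block_row G i j" | "block_index G N r = None"
  unfolding block_index_def by meson

lemma block_shift_row [simp]:
  "i < N \<Longrightarrow> j < 3 \<Longrightarrow> block_shift G N W (block_row G i j) c = block_val G W i j c"
  "block_index G N r = None \<Longrightarrow> block_shift G N W r c = r"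
  by (simp_all add: block_shift_def)

lemma top_shift_row [simp]:
  "i < N \<Longrightarrow> j < 3 \<Longrightarrow> top_shift G N (block_row G i j) = block_top G i"
  "block_index G N r = None \<Longrightarrow> top_shift G N r = r"
  by (simp_all add: top_shift_def)

lemma block_val_row: "\<exists>j' < 3. block_val G W i j c = block_row G i j'"
proof -
  have "gadget (W i) j (int c) \<in> {0, 1, 3}" "band (W i) j (int c) \<in> {0, 1, 2}"
    by (auto simp: gadget_def band_def)
  then show ?thesis
    \<comment> \<open>In a gadget the offset \<open>3\<close> belongs to the row of index
      \<open>2\<close>; every other offset is itself the index.\<close>
    by (intro exI[of _ "if gadget (W i) j (int c) = 3 \<and> i < G then 2 else block_val G W i j c - block_base G i"])
      (auto simp: block_val_def block_row_def)
qed

definition block_words :: "nat \<Rightarrow> nat \<Rightarrow> nat \<Rightarrow> (nat \<Rightarrow> int \<Rightarrow> nat) \<Rightarrow> bool" where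
  "block_words n G N W \<longleftrightarrow>
     (\<forall>i<N. word_mod n (W i) \<and> (if i < G then spaced_word (W i) else proper_word (W i)))"

lemma block_val_inj_col:
  assumes "block_words n G N W" "i < N" "block_val G W i j c = block_val G W i j' c" "j < 3" "j' < 3"
  shows "j = j'"
proof (cases "i < G")
  case True
  then have "inj_on (\<lambda>j. gadget (W i) j (int c)) {..<3}"
    using assms by (intro gadget_inj_col) (auto simp: block_words_def)
  then show ?thesis using assms True by (auto simp: block_val_def dest: inj_onD)
next
  case False
  then have "inj_on (\<lambda>j. band (W i) j (int c)) {..<3}"
    using assms by (intro band_inj_col) (auto simp: block_words_def)
  then show ?thesis using assms False by (auto simp: block_val_def dest: inj_onD)
qed

lemma block_row_less:
  assumes "i < N" "j < 3" "G + 3 * N \<le> n" "G \<le> N"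
  shows "block_row G i j < n"
  using assms unfolding block_row_def block_base_def by auto

lemma latin_square_block_shift:
  assumes W: "block_words n G N W" and n: "G + 3 * N \<le> n" "G \<le> N"
  shows "latin_square n (shifted_square n (block_shift G N W))"
proof (rule latin_square_shifted)
  show "block_shift G N W r c < n" if "r < n" for r c
  proof (cases rule: block_index_cases[of N r G])
    case (1 i j)
    then show ?thesis using block_val_row[of G W i j c] block_row_less[OF _ _ n] by auto
  qed (use that in simp)
next
  fix c
  show "inj_on (\<lambda>r. block_shift G N W r c) {..<n}"
  proof (rule inj_onI)
    fix r r' assume eq: "block_shift G N W r c = block_shift G N W r' c"
    \<comment> \<open>In each column a block only permutes its own rows, so collisions between
      different blocks, or with rows outside, are impossible.\<close>
    have idx: "block_index G N (block_shift G N W r c) = None \<longleftrightarrow> block_index G N r = None" for r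
    proof (cases rule: block_index_cases[of N r G])
      case (1 i j)
      then show ?thesis using block_val_row[of G W i j c] by auto
    qed simp
    show "r = r'"
    proof (cases rule: block_index_cases[of N r G])
      case r: (1 i j)
      show ?thesis
      proof (cases rule: block_index_cases[of N r' G])
        case r': (1 i' j')
        obtain k k' where k: "k < 3" "k' < 3" "block_val G W i j c = block_row G i k"
          "block_val G W i' j' c = block_row G i' k'"
          using block_val_row by metis
        have "i = i'" using eq r r' k block_row_inject[of G i k i' k'] by simp
        then have "j = j'" using eq r r' block_val_inj_col[OF W, of i j c j'] by simp
        then show ?thesis using r r' \<open>i = i'\<close> by simp
      next
        case 2
        then show ?thesis using r eq idx[of r] idx[of r'] by simp
      qed
    next
      case 2
      then have "block_index G N r' = None" using eq idx[of r] idx[of r'] by simp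
      then show ?thesis using eq 2 by simp
    qed
  qed
next
  fix r
  show "inj_on (\<lambda>c. (c + block_shift G N W r c) mod n) {..<n}"
  proof (cases rule: block_index_cases[of N r G])
    case (1 i j)
    show ?thesis
    proof (cases "i < G")
      case True
      then show ?thesis
        using 1 W gadget_inj_row[of n "W i" "block_base G i" j] by (simp add: block_val_def block_words_def)
    next
      case False
      then show ?thesis
        using 1 W band_inj_row[of n "W i" "block_base G i" j] by (simp add: block_val_def block_words_def)
    qed
  next
    case 2
    have "inj_on (\<lambda>c. (c + (r + (\<lambda>_. 0) (int c))) mod n) {..<n}"
      by (rule inj_on_shift) (auto simp: word_mod_def)
    then show ?thesis using 2 by simp
  qed
qed

section \<open>Row sums and transversals of the block square\<close>

lemma sum_block_index:
  fixes h :: "nat \<Rightarrow> nat \<Rightarrow> nat"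
  assumes n: "G + 3 * N \<le> n" "G \<le> N"
  shows "(\<Sum>r<n. case block_index G N r of None \<Rightarrow> 0 | Some (i, j) \<Rightarrow> h i j) = (\<Sum>i<N. \<Sum>j<3. h i j)"
    (is "sum ?F _ = _")
proof -
  let ?R = "(\<lambda>(i, j). block_row G i j) ` ({..<N} \<times> {..<3})"
  have inj: "inj_on (\<lambda>(i, j). block_row G i j) ({..<N} \<times> {..<3})"
  proof (rule inj_onI)
    fix p p' :: "nat \<times> nat"
    assume p: "p \<in> {..<N} \<times> {..<3}" "p' \<in> {..<N} \<times> {..<3}"
      "(case p of (i, j) \<Rightarrow> block_row G i j) = (case p' of (i, j) \<Rightarrow> block_row G i j)"
    obtain i j i' j' where "p = (i, j)" "p' = (i', j')" by (meson surj_pair)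
    then show "p = p'" using p block_row_inject[of G i j i' j'] by simp
  qed
  have "sum ?F {..<n} = sum ?F ?R"
  proof (rule sum.mono_neutral_right)
    show "?R \<subseteq> {..<n}" using block_row_less[OF _ _ n] by auto
    show "\<forall>r \<in> {..<n} - ?R. ?F r = 0"
    proof
      fix r assume r: "r \<in> {..<n} - ?R"
      show "?F r = 0"
      proof (cases rule: block_index_cases[of N r G])
        case (1 i j)
        then have "r \<in> ?R" by (intro image_eqI[of _ _ "(i, j)"]) auto
        then show ?thesis using r by simp
      qed simp
    qed
  qed simp
  also have "\<dots> = (\<Sum>p\<in>{..<N} \<times> {..<3}. ?F (case p of (i, j) \<Rightarrow> block_row G i j))"
    by (simp add: sum.reindex[OF inj])
  also have "\<dots> = (\<Sum>p\<in>{..<N} \<times> {..<3}. case p of (i, j) \<Rightarrow> h i j)"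
    by (rule sum.cong) auto
  also have "\<dots> = (\<Sum>i<N. \<Sum>j<3. h i j)"
    by (simp add: sum.cartesian_product)
  finally show ?thesis .
qed

lemma sum_if_less:
  assumes "G \<le> (N::nat)"
  shows "(\<Sum>i<N. if i < G then a else b) = G * a + (N - G) * (b::nat)"
proof -
  have "{..<N} = {..<G} \<union> {G..<N}" using assms by auto
  moreover have "(\<Sum>i\<in>{..<G} \<union> {G..<N}. if i < G then a else b) =
    (\<Sum>i<G. if i < G then a else b) + (\<Sum>i=G..<N. if i < G then a else b)"
    by (rule sum.union_disjoint) auto
  ultimately show ?thesis by simp
qed

lemma sum_lessThan_3: "(\<Sum>j<3::nat. h j) = h 0 + h 1 + (h 2 :: nat)"
  by (simp add: lessThan_3)

text \<open>This is where \<open>m = 3 * N + 2 * G\<close> comes from: the rows sum to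
  \<open>m * (n - 1)\<close>, and raising them to the block tops adds \<open>5\<close> per gadget
  and \<open>3\<close> per band, that is \<open>5 * G + 3 * (N - G) = m\<close>.\<close>

lemma sum_top_shift:
  assumes n: "n = 2 * m" "m = 3 * N + 2 * G" and G: "G \<le> N"
  shows "(\<Sum>r<n. top_shift G N r) = m * n"
proof -
  let ?h = "\<lambda>i j. block_top G i - block_row G i j"
  have n': "G + 3 * N \<le> n" using n by simp
  have "top_shift G N r = r + (case block_index G N r of None \<Rightarrow> 0 | Some (i, j) \<Rightarrow> ?h i j)" for r
  proof (cases rule: block_index_cases[of N r G])
    case (1 i j)
    then have "block_row G i j \<le> block_top G i" by (auto simp: block_row_def block_top_def)
    then show ?thesis using 1 by simp
  qed simp
  then have "(\<Sum>r<n. top_shift G N r) = (\<Sum>r<n. r) + (\<Sum>i<N. \<Sum>j<3. ?h i j)"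
    using sum_block_index[OF n' G, of ?h] by (simp add: sum.distrib)
  also have "(\<Sum>i<N. \<Sum>j<3. ?h i j) = (\<Sum>i<N. if i < G then 5 else 3)"
    unfolding sum_lessThan_3 by (rule sum.cong) (auto simp: block_row_def block_top_def)
  also have "\<dots> = m" using G n by (simp add: sum_if_less diff_mult_distrib)
  also have "(\<Sum>r<n. r) = m * (n - 1)"
  proof -
    have "2 * (\<Sum>r<k. r) = k * (k - 1)" for k :: nat
    proof (induction k)
      case (Suc k)
      then show ?case by (cases k) (simp_all add: algebra_simps)
    qed simp
    moreover have "n * (n - 1) = 2 * (m * (n - 1))" by (metis n(1) mult.assoc)
    ultimately have "2 * (\<Sum>r<n. r) = 2 * (m * (n - 1))" by metis
    then show ?thesis by simp
  qed
  also have "m * (n - 1) + m = m * n"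
  proof (cases "n = 0")
    case True
    then show ?thesis using n(1) by simp
  next
    case False
    then have "n - 1 + 1 = n" by simp
    then show ?thesis by (metis distrib_left mult.right_neutral)
  qed
  finally show ?thesis .
qed

text \<open>The largest total deficit is \<open>9 * G + 6 * (N - G) = 6 * N + 3 * G\<close>, which
  is below \<open>n = 6 * N + 4 * G\<close> as soon as there is a gadget.\<close>

lemma block_transversal_top:
  assumes n: "n = 2 * m" "m = 3 * N + 2 * G" and G: "0 < G" "G \<le> N"
    and T: "transversal n (shifted_square n (block_shift G N W)) T" "(r, c, s) \<in> T"
  shows "block_shift G N W r c = top_shift G N r"
proof (rule transversal_attains_bound[OF T])
  let ?h = "\<lambda>i j. if i < G then 3 else 2 :: nat"
  define d where "d r = (case block_index G N r of None \<Rightarrow> 0 | Some (i, j) \<Rightarrow> ?h i j)" for r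
  show "block_shift G N W r c \<le> top_shift G N r \<and> top_shift G N r \<le> block_shift G N W r c + d r" for r c
  proof (cases rule: block_index_cases[of N r G])
    case (1 i j)
    then show ?thesis by (auto simp: d_def block_val_def block_top_def gadget_def band_def)
  qed (simp add: d_def)
  show "n dvd (\<Sum>r<n. top_shift G N r)" using sum_top_shift[OF n G(2)] by simp
  have n': "G + 3 * N \<le> n" using n by simp
  have "(\<Sum>r<n. d r) = (\<Sum>i<N. if i < G then 9 else 6)"
    unfolding d_def sum_block_index[OF n' G(2)] by (rule sum.cong) auto
  also have "\<dots> < n" using G n by (simp add: sum_if_less diff_mult_distrib)
  finally show "(\<Sum>r<n. d r) < n" .
qed

text \<open>The columns \<open>\<sigma>\<close> are redistributed within each block by
  \<open>\<rho>\<close>, so that each goes to the row whose shift there is the block top. Symbols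
  stay the same, and \<open>\<rho>\<close> is a permutation because the three letters of a block
  differ.\<close>

lemma ex_block_transversal:
  assumes W: "block_words n G N W" and n: "G + 3 * N \<le> n" "G \<le> N"
    and \<sigma>: "bij_betw \<sigma> {..<n} {0..<int n}"
    and \<tau>: "bij_betw (\<lambda>r. (int (top_shift G N r) + \<sigma> r) mod int n) {..<n} {0..<int n}"
    and inj: "\<And>i. i < N \<Longrightarrow> inj_on (\<lambda>j. W i (\<sigma> (block_row G i j))) {..<3}"
  shows "\<exists>T. transversal n (shifted_square n (block_shift G N W)) T"
proof -
  define \<rho> where "\<rho> r = (case block_index G N r of None \<Rightarrow> r | Some (i, j) \<Rightarrow> block_row G i (W i (\<sigma> r)))" for r
  have W3: "W i x < 3" if "i < N" for i x
    using W that unfolding block_words_def spaced_word_def proper_word_def by metis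
  have \<rho>_row: "\<rho> (block_row G i j) = block_row G i (W i (\<sigma> (block_row G i j)))" if "i < N" "j < 3" for i j
    using that by (simp add: \<rho>_def)
  have \<rho>_none: "\<rho> r = r" if "block_index G N r = None" for r using that by (simp add: \<rho>_def)
  have \<rho>_idx: "block_index G N (\<rho> r) = None \<longleftrightarrow> block_index G N r = None" for r
  proof (cases rule: block_index_cases[of N r G])
    case (1 i j) then show ?thesis using W3 \<rho>_row by simp
  qed (simp add: \<rho>_none)
  have \<rho>_less: "\<rho> r < n" if "r < n" for r
  proof (cases rule: block_index_cases[of N r G])
    case (1 i j) then show ?thesis using W3 \<rho>_row block_row_less[OF _ _ n] by simp
  qed (use that in \<open>simp add: \<rho>_none\<close>)
  have \<rho>_inj: "inj_on \<rho> {..<n}"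
  proof (rule inj_onI)
    fix r r' assume eq: "\<rho> r = \<rho> r'"
    show "r = r'"
    proof (cases rule: block_index_cases[of N r G])
      case r: (1 i j)
      show ?thesis
      proof (cases rule: block_index_cases[of N r' G])
        case r': (1 i' j')
        have "i = i' \<and> W i (\<sigma> r) = W i' (\<sigma> r')"
          using eq r r' block_row_inject[OF _ W3 W3] by (simp add: \<rho>_row)
        then show ?thesis using r r' inj[of i] by (auto dest: inj_onD)
      next
        case 2
        then show ?thesis using r eq \<rho>_idx[of r] \<rho>_idx[of r'] by simp
      qed
    next
      case 2
      then show ?thesis using eq \<rho>_idx[of r] \<rho>_idx[of r'] by (simp add: \<rho>_none)
    qed
  qed
  have \<rho>_im: "\<rho> ` {..<n} = {..<n}"
    using \<rho>_less \<rho>_inj by (intro endo_inj_surj) auto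
  have top: "block_shift G N W (\<rho> r) (nat (\<sigma> r)) = top_shift G N r" if "r < n" for r
  proof (cases rule: block_index_cases[of N r G])
    case (1 i j)
    have "\<sigma> r \<in> {0..<int n}" using \<sigma> that by (auto simp: bij_betw_def)
    then have e: "int (nat (\<sigma> r)) = \<sigma> r" by simp
    have "block_shift G N W (\<rho> r) (nat (\<sigma> r)) = block_val G W i (W i (\<sigma> r)) (nat (\<sigma> r))"
      using 1 W3 by (simp add: \<rho>_row)
    also have "\<dots> = block_top G i" unfolding block_val_def e by (simp add: gadget_def band_def block_top_def)
    finally show ?thesis using 1 by simp
  qed (simp add: \<rho>_none)
  define \<tau>' where "\<tau>' r = (int (top_shift G N r) + \<sigma> r) mod int n" for r
  have nat_bij: "bij_betw nat {0..<int n} {..<n}"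
    by (rule bij_betw_byWitness[of _ int]) auto
  have \<sigma>n: "bij_betw (\<lambda>r. nat (\<sigma> r)) {..<n} {..<n}"
    using bij_betw_trans[OF \<sigma> nat_bij] by (simp add: comp_def)
  have \<tau>n: "bij_betw (\<lambda>r. nat (\<tau>' r)) {..<n} {..<n}"
    using bij_betw_trans[OF \<tau> nat_bij] by (simp add: comp_def \<tau>'_def)
  define e where "e r = (\<rho> r, nat (\<sigma> r), nat (\<tau>' r))" for r
  have "e r \<in> shifted_square n (block_shift G N W)" if "r < n" for r
  proof -
    have "\<sigma> r \<in> {0..<int n}" using \<sigma> that by (auto simp: bij_betw_def)
    then have s: "\<sigma> r = int (nat (\<sigma> r))" "nat (\<sigma> r) < n" by auto
    have "\<tau>' r = int ((top_shift G N r + nat (\<sigma> r)) mod n)"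
      unfolding \<tau>'_def by (subst s(1)) (simp add: zmod_int)
    then have "nat (\<tau>' r) = (nat (\<sigma> r) + top_shift G N r) mod n" by (simp add: add.commute)
    then show ?thesis using top[OF that] s(2) \<rho>_less[OF that] by (simp add: e_def shifted_square_def)
  qed
  then have "e ` {..<n} \<subseteq> shifted_square n (block_shift G N W)" by auto
  moreover have "card (e ` {..<n}) = n"
  proof -
    have "inj_on e {..<n}" using \<rho>_inj by (auto simp: inj_on_def e_def)
    then show ?thesis by (simp add: card_image)
  qed
  moreover have "(\<lambda>(r, c, s). r) ` e ` {..<n} = {0..<n}" "(\<lambda>(r, c, s). c) ` e ` {..<n} = {0..<n}"
    "(\<lambda>(r, c, s). s) ` e ` {..<n} = {0..<n}"
    using \<rho>_im \<sigma>n \<tau>n unfolding bij_betw_def by (simp_all add: image_image e_def atLeast0LessThan)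
  ultimately show ?thesis unfolding transversal_def by blast
qed

text \<open>The words are chosen after \<open>\<sigma>\<close>: each gives the three columns of its
  block different letters, while all bands beyond the two anchor bands share the zero
  \<open>a\<close>.\<close>

lemma ex_block_words:
  assumes n: "even n" "16 \<le> n" "G + 3 * N \<le> n" "G + 2 \<le> N"
    and \<sigma>: "bij_betw \<sigma> {..<n} {0..<int n}"
  obtains W a b x where "block_words n G N W"
    "\<And>i. i < N \<Longrightarrow> inj_on (\<lambda>j. W i (\<sigma> (block_row G i j))) {..<3}"
    "\<And>i c. i \<in> {G, G + 1} \<Longrightarrow> c \<in> {0..<int n} \<Longrightarrow> W i c = 0 \<longleftrightarrow> c = a \<or> c = b"
    "\<And>i c. i \<in> {G + 2..<N} \<Longrightarrow> c \<in> {0..<int n} \<Longrightarrow> W i c = 0 \<longleftrightarrow> c = a \<or> c = x i"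
    "\<And>i. i \<in> {G + 2..<N} \<Longrightarrow> x i \<in> {0..<int n}"
proof -
  define t where "t i j = \<sigma> (block_row G i j)" for i j
  have GN: "G \<le> N" using n by simp
  have t_in: "t i ` {..<3} \<subseteq> {0..<int n}" if "i < N" for i
    using \<sigma> block_row_less[OF that _ n(3) GN] by (auto simp: t_def bij_betw_def)
  have t_eq: "i = i' \<and> j = j'" if "t i j = t i' j'" "i < N" "i' < N" "j < 3" "j' < 3" for i j i' j'
  proof -
    have "block_row G i j < n" "block_row G i' j' < n"
      using that block_row_less[OF _ _ n(3) GN] by auto
    then have "block_row G i j = block_row G i' j'"
      using that(1) \<sigma> by (auto simp: t_def bij_betw_def dest: inj_onD)
    then show ?thesis using that block_row_inject by blast
  qed
  have t_inj: "inj_on (t i) {..<3}" if "i < N" for i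
    using t_eq[OF _ that that] by (auto intro: inj_onI)
  have t_disj: "t i ` {..<3} \<inter> t i' ` {..<3} = {}" if "i < N" "i' < N" "i \<noteq> i'" for i i'
    using t_eq[OF _ that(1,2)] that(3) by blast
  have GN2: "G < N" "G + 1 < N" "G \<noteq> G + 1" using n(4) by auto
  obtain w w' a b where w: "word_mod n w" "proper_word w" "word_mod n w'" "proper_word w'"
    "a \<in> t G ` {..<3}" "b \<in> t (G + 1) ` {..<3}" "inj_on (w \<circ> t G) {..<3}" "inj_on (w' \<circ> t (G + 1)) {..<3}"
    "\<forall>c\<in>{0..<int n}. w c = 0 \<longleftrightarrow> c = a \<or> c = b"
    "\<forall>c\<in>{0..<int n}. w' c = 0 \<longleftrightarrow> c = a \<or> c = b"
    using ex_mutually_anchored_words[OF n(1) t_inj[OF GN2(1)] t_in[OF GN2(1)] t_inj[OF GN2(2)]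
        t_in[OF GN2(2)] t_disj[OF GN2]] .
  define P where "P i v y \<longleftrightarrow> word_mod n v \<and> (if i < G then spaced_word v else proper_word v) \<and>
    inj_on (v \<circ> t i) {..<3} \<and>
    (i \<in> {G, G + 1} \<longrightarrow> (\<forall>c \<in> {0..<int n}. v c = 0 \<longleftrightarrow> c = a \<or> c = b)) \<and>
    (i \<in> {G + 2..<N} \<longrightarrow> y \<in> {0..<int n} \<and> (\<forall>c \<in> {0..<int n}. v c = 0 \<longleftrightarrow> c = a \<or> c = y))" for i v y
  have ex: "\<exists>v y. P i v y" if i: "i < N" for i
  proof -
    consider "i < G" | "i = G" | "i = G + 1" | "i \<in> {G + 2..<N}" using i by force
    then show ?thesis
    proof cases
      case 1
      obtain v where "word_mod n v" "spaced_word v" "inj_on (v \<circ> t i) {..<3}"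
        using ex_spaced_word[OF t_inj[OF i] t_in[OF i] n(2)] .
      then show ?thesis using 1 by (auto simp: P_def)
    next
      case 2
      \<comment> \<open>The \<open>0\<close> is a dummy; the private column matters only for blocks
        from \<open>G + 2\<close> on.\<close>
      then have "P i w 0" using w by (simp add: P_def)
      then show ?thesis by blast
    next
      case 3
      then have "P i w' 0" using w by (simp add: P_def)
      then show ?thesis by blast
    next
      case 4
      \<comment> \<open>\<open>a\<close> was chosen among the columns of block \<open>G\<close>, and
        different blocks have disjoint columns.\<close>
      then have ai: "a \<in> {0..<int n} - t i ` {..<3}"
        using w(5) t_in[OF GN2(1)] t_disj[OF GN2(1) i] by auto
      obtain v y where v: "word_mod n v" "proper_word v" "y \<in> t i ` {..<3}" "inj_on (v \<circ> t i) {..<3}"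
        "\<forall>c\<in>{0..<int n}. v c = 0 \<longleftrightarrow> c = a \<or> c = y"
        using ex_anchored_word[OF n(1) t_inj[OF i] t_in[OF i] ai] .
      then have "P i v y" using 4 t_in[OF i] unfolding P_def by auto
      then show ?thesis by blast
    qed
  qed
  obtain W x where Wx: "\<And>i. i < N \<Longrightarrow> P i (W i) (x i)"
    using ex by metis
  show thesis
  proof (rule that[of W a b x])
    show "block_words n G N W" using Wx by (auto simp: block_words_def P_def)
    show "inj_on (\<lambda>j. W i (\<sigma> (block_row G i j))) {..<3}" if "i < N" for i
      using Wx[OF that] by (simp add: P_def comp_def t_def)
    show "W i c = 0 \<longleftrightarrow> c = a \<or> c = b" if i: "i \<in> {G, G + 1}" and c: "c \<in> {0..<int n}" for i c
    proof -
      have "i < N" using i n(4) by auto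
      from Wx[OF this] i have "\<forall>c \<in> {0..<int n}. W i c = 0 \<longleftrightarrow> c = a \<or> c = b"
        by (simp only: P_def simp_thms, elim conjE)
      then show ?thesis using c by (rule bspec)
    qed
    have *: "x i \<in> {0..<int n} \<and> (\<forall>c \<in> {0..<int n}. W i c = 0 \<longleftrightarrow> c = a \<or> c = x i)"
      if i: "i \<in> {G + 2..<N}" for i
    proof -
      have "i < N" using i by simp
      from Wx[OF this] i show ?thesis
        by (simp only: P_def simp_thms; elim conjE)
    qed
    show "W i c = 0 \<longleftrightarrow> c = a \<or> c = x i" if "i \<in> {G + 2..<N}" "c \<in> {0..<int n}" for i c
      by (rule bspec[OF conjunct2[OF *[OF that(1)]] that(2)])
    show "x i \<in> {0..<int n}" if "i \<in> {G + 2..<N}" for i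
      by (rule conjunct1[OF *[OF that]])
  qed
qed

subsection \<open>Forced entries and counting\<close>

text \<open>Blocks \<open>G\<close> and \<open>G + 1\<close> are the anchor bands. No transversal is
  assumed here: the zeros of the words alone determine what every transversal must contain.\<close>

locale anchored_blocks =
  fixes n m G N :: nat and W :: "nat \<Rightarrow> int \<Rightarrow> nat" and a b :: int and x :: "nat \<Rightarrow> int"
  assumes n: "n = 2 * m" "m = 3 * N + 2 * G" and G: "0 < G" and N: "G + 2 \<le> N"
    and words: "block_words n G N W"
    and anchor: "i \<in> {G, G + 1} \<Longrightarrow> c \<in> {0..<int n} \<Longrightarrow> W i c = 0 \<longleftrightarrow> c = a \<or> c = b"
    and anchored: "i \<in> {G + 2..<N} \<Longrightarrow> c \<in> {0..<int n} \<Longrightarrow> W i c = 0 \<longleftrightarrow> c = a \<or> c = x i"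
    and x_range: "i \<in> {G + 2..<N} \<Longrightarrow> x i \<in> {0..<int n}"
begin

abbreviation "L \<equiv> shifted_square n (block_shift G N W)"
abbreviation "K \<equiv> {G + 2..<N}"

lemma n': "G + 3 * N \<le> n" "G \<le> N" "0 < n"
  using n N G by auto

lemma latin: "latin_square n L"
  by (rule latin_square_block_shift[OF words n'(1,2)])

definition forced :: "nat \<Rightarrow> entry" where
  "forced i = (block_row G i 0, nat (x i), (nat (x i) + block_top G i) mod n)"

text \<open>The first row of a band attains the block top only in columns whose letter is
  \<open>0\<close>.\<close>

lemma transversal_first_row:
  assumes T: "transversal n L T" and i: "G \<le> i" "i < N"
  obtains c where "c < n" "(block_row G i 0, c, (c + block_top G i) mod n) \<in> T" "W i (int c) = 0"
proof -
  have "block_row G i 0 < n" using block_row_less[OF i(2) _ n'(1,2)] by simp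
  then have "block_row G i 0 \<in> (\<lambda>(r, c, s). r) ` T" using T by (simp add: transversal_def)
  then obtain c s where e: "(block_row G i 0, c, s) \<in> T" by force
  then have cs: "c < n" "s = (c + block_shift G N W (block_row G i 0) c) mod n"
    using T by (auto simp: transversal_def shifted_square_def)
  have top: "block_shift G N W (block_row G i 0) c = block_top G i"
    using block_transversal_top[OF n G n'(2) T e] i by simp
  then have "band (W i) 0 (int c) = 2" using i by (simp add: block_val_def block_top_def)
  then have "W i (int c) = 0" by (simp add: band_def split: if_splits)
  then show thesis using that cs e top by simp
qed

text \<open>The first rows of both anchor bands lie in distinct columns among \<open>a\<close> and
  \<open>b\<close>, so they occupy both. The first row of band \<open>i\<close> is left with
  \<open>x i\<close>.\<close>

lemma transversal_forced:
  assumes T: "transversal n L T" and i: "i \<in> K"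
  shows "forced i \<in> T"
proof -
  note inj = transversal_sums(5)[OF T shifted_square_subset[OF n'(3)]]
  have ne: "c \<noteq> c'" if "(block_row G k 0, c, s) \<in> T" "(block_row G k' 0, c', s') \<in> T" "k \<noteq> k'" for k k' c c' s s'
  proof
    assume "c = c'"
    then have "block_row G k 0 = block_row G k' 0" using inj_onD[OF inj, OF _ that(1,2)] by simp
    then show False using that(3) block_row_inject[of G k 0 k' 0] by simp
  qed
  obtain c where c: "c < n" "(block_row G i 0, c, (c + block_top G i) mod n) \<in> T" "W i (int c) = 0"
    using transversal_first_row[OF T, of i] i by auto
  obtain c1 where c1: "c1 < n" "(block_row G G 0, c1, (c1 + block_top G G) mod n) \<in> T" "W G (int c1) = 0"
    using transversal_first_row[OF T, of G] N by auto
  obtain c2 where c2: "c2 < n" "(block_row G (G + 1) 0, c2, (c2 + block_top G (G + 1)) mod n) \<in> T"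
    "W (G + 1) (int c2) = 0"
    using transversal_first_row[OF T, of "G + 1"] N by auto
  have "int c1 = a \<or> int c1 = b" "int c2 = a \<or> int c2 = b" "int c = a \<or> int c = x i"
    using anchor[of G "int c1"] anchor[of "G + 1" "int c2"] anchored[OF i, of "int c"] c c1 c2 by auto
  moreover have "c1 \<noteq> c2" "c \<noteq> c1" "c \<noteq> c2"
    using ne[OF c1(2) c2(2)] ne[OF c(2) c1(2)] ne[OF c(2) c2(2)] i by auto
  ultimately have "int c = x i" by auto
  then have "c = nat (x i)" by simp
  then show ?thesis using c(2) by (simp add: forced_def)
qed

end

section \<open>Counting transversal-free entries\<close>

lemma card_avoiding:
  fixes h :: "nat \<Rightarrow> nat"
  assumes h: "inj_on h {..<n}" and F: "finite A" "finite B"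
  shows "n \<le> card {c. c < n \<and> c \<notin> A \<and> h c \<notin> B} + card A + card B"
proof -
  let ?P = "{c. c < n \<and> c \<notin> A \<and> h c \<notin> B}" and ?H = "{c. c < n \<and> h c \<in> B}"
  have "card ?H \<le> card B"
    by (rule card_inj_on_le[of h]) (use h F in \<open>auto simp: inj_on_def\<close>)
  moreover have "n \<le> card (?P \<union> A \<union> ?H)"
    using card_mono[of "?P \<union> A \<union> ?H" "{..<n}"] F by auto
  moreover have "card (?P \<union> A \<union> ?H) \<le> card ?P + card A + card ?H"
    by (meson add_le_mono1 card_Un_le le_trans)
  ultimately show ?thesis by linarith
qed

lemma card_shifted_square: "card (shifted_square n g) = n * n"
proof -
  have "shifted_square n g = (\<lambda>(r, c). (r, c, (c + g r c) mod n)) ` ({..<n} \<times> {..<n})"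
    by (auto simp: shifted_square_def image_iff)
  moreover have "inj_on (\<lambda>(r, c). (r, c, (c + g r c) mod n)) ({..<n} \<times> {..<n})"
    by (auto simp: inj_on_def)
  ultimately show ?thesis by (simp add: card_image card_cartesian_product)
qed

lemma tau_less:
  assumes T: "transversal n (shifted_square n g) T" and n: "n > 0"
  shows "tau n (shifted_square n g) < n\<^sup>2"
proof -
  let ?L = "shifted_square n g"
  have "T \<noteq> {}" using T n by (auto simp: transversal_def)
  then obtain e where "e \<in> T" by blast
  then have "e \<in> ?L" "\<not> transversal_free n ?L e"
    using T by (auto simp: transversal_def transversal_free_def)
  then have "{e. transversal_free n ?L e} \<subset> ?L"
    by (auto simp: transversal_free_def)
  moreover have "finite ?L" by (rule finite_subset[OF shifted_square_subset[OF n]]) auto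
  ultimately have "card {e. transversal_free n ?L e} < card ?L" by (intro psubset_card_mono)
  then show ?thesis by (simp add: tau_def card_shifted_square power2_eq_square)
qed

context anchored_blocks
begin

abbreviation "cols \<equiv> (\<lambda>i. nat (x i)) ` K"
abbreviation "syms \<equiv> (\<lambda>i. (nat (x i) + block_top G i) mod n) ` K"

text \<open>All forced entries lie in one transversal and have different rows, hence also different
  columns and symbols.\<close>

lemma forced_inj:
  assumes T: "transversal n L T"
  shows "inj_on (\<lambda>i. nat (x i)) K" "inj_on (\<lambda>i. (nat (x i) + block_top G i) mod n) K"
proof -
  note sums = transversal_sums[OF T shifted_square_subset[OF n'(3)]]
  have F: "forced i \<in> T" if "i \<in> K" for i using transversal_forced[OF T that] .
  have eq: "i = j" if "forced i = forced j" for i j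
  proof -
    have "fst (forced i) = fst (forced j)" using that by (rule arg_cong)
    then have "block_row G i 0 = block_row G j 0" by (simp only: forced_def fst_conv)
    then show ?thesis by (rule block_row_inject[THEN conjunct1]) simp_all
  qed
  show "inj_on (\<lambda>i. nat (x i)) K"
  proof (rule inj_onI)
    fix i j assume ij: "i \<in> K" "j \<in> K" "nat (x i) = nat (x j)"
    have "forced i = forced j"
      by (rule inj_onD[OF sums(5) _ F[OF ij(1)] F[OF ij(2)]]) (simp add: forced_def ij(3))
    then show "i = j" by (rule eq)
  qed
  show "inj_on (\<lambda>i. (nat (x i) + block_top G i) mod n) K"
  proof (rule inj_onI)
    fix i j assume ij: "i \<in> K" "j \<in> K" "(nat (x i) + block_top G i) mod n = (nat (x j) + block_top G j) mod n"
    have "forced i = forced j"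
      by (rule inj_onD[OF sums(6) _ F[OF ij(1)] F[OF ij(2)]]) (simp add: forced_def ij(3))
    then show "i = j" by (rule eq)
  qed
qed

lemma transversal_entry:
  assumes T: "transversal n L T" and e: "(r, c, s) \<in> T" and nf: "(r, c, s) \<notin> forced ` K"
  shows "c \<notin> cols" "s \<notin> syms" "r \<notin> (\<lambda>i. block_row G i 0) ` K" "block_shift G N W r c = top_shift G N r"
proof -
  note sums = transversal_sums[OF T shifted_square_subset[OF n'(3)]]
  have ne: False if i: "i \<in> K" and "r = block_row G i 0 \<or> c = nat (x i) \<or> s = (nat (x i) + block_top G i) mod n" for i
  proof -
    have F: "forced i \<in> T" by (rule transversal_forced[OF T i])
    from that(2) have "(r, c, s) = forced i"
    proof (elim disjE)
      assume "r = block_row G i 0"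
      then show ?thesis by (intro inj_onD[OF sums(4) _ e F]) (simp add: forced_def)
    next
      assume "c = nat (x i)"
      then show ?thesis by (intro inj_onD[OF sums(5) _ e F]) (simp add: forced_def)
    next
      assume "s = (nat (x i) + block_top G i) mod n"
      then show ?thesis by (intro inj_onD[OF sums(6) _ e F]) (simp add: forced_def)
    qed
    then show False using nf i by blast
  qed
  show "c \<notin> cols" "s \<notin> syms" "r \<notin> (\<lambda>i. block_row G i 0) ` K" using ne by blast+
  show "block_shift G N W r c = top_shift G N r"
    by (rule block_transversal_top[OF n G n'(2) T e])
qed

text \<open>Only columns and symbols of forced entries are excluded; conflicts in their rows are
  counted in \<open>band_free\<close>.\<close>

definition unforced :: "entry set" where
  "unforced = {(r, c, s) \<in> L. c \<notin> cols \<and> s \<notin> syms}"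

text \<open>In rows \<open>1\<close> and \<open>2\<close> only the smallest shift is counted. The
  middle shift occurs there only at a letter \<open>0\<close> or just after one, so leaving it out
  costs boundedly many entries per band.\<close>

definition band_free :: "nat \<Rightarrow> entry set" where
  "band_free i = {(r, c, s) \<in> unforced. r = block_row G i 0 \<or>
     (\<exists>j \<in> {1, 2}. r = block_row G i j \<and> block_shift G N W r c = block_base G i)}"

lemma finite_L: "finite L"
  by (rule finite_subset[OF shifted_square_subset[OF n'(3)]]) auto

lemma row_inj:
  assumes "r < n" shows "inj_on (\<lambda>c. (c + block_shift G N W r c) mod n) {..<n}"
proof (rule inj_onI)
  fix c c' assume c: "c \<in> {..<n}" "c' \<in> {..<n}"
    and eq: "(c + block_shift G N W r c) mod n = (c' + block_shift G N W r c') mod n"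
  let ?s = "(c + block_shift G N W r c) mod n"
  have "(r, c, ?s) \<in> L" "(r, c', ?s) \<in> L" "?s < n"
    using assms c eq n' by (auto simp: shifted_square_def)
  then show "c = c'" using latin assms unfolding latin_square_def by blast
qed

text \<open>The first row contributes one entry per column. The row named by the preceding letter,
  which has the smallest shift, contributes another. Forced columns and symbols remove at most
  \<open>2 * card K\<close> from each family, and \<open>2\<close> more are lost as explained at
  \<open>?Z\<close>.\<close>

lemma card_band_free:
  assumes i: "i \<in> K"
  shows "2 * n \<le> card (band_free i) + 4 * card K + 2"
proof -
  have cK: "card cols \<le> card K" "card syms \<le> card K" by (rule card_image_le, simp)+
  have iN: "i < N" "\<not> i < G" using i by auto
  have row: "block_row G i j < n" if "j < 3" for j using block_row_less[OF iN(1) that n'(1,2)] .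
  let ?r = "block_row G i 0"
  let ?h = "\<lambda>c. (c + block_shift G N W ?r c) mod n"
  let ?P = "{c. c < n \<and> c \<notin> cols \<and> ?h c \<notin> syms}"
  have P: "n \<le> card ?P + card cols + card syms"
    by (rule card_avoiding[OF row_inj]) (use row in auto)
  let ?k = "\<lambda>c. (c + block_base G i) mod n"
  \<comment> \<open>In these columns the smallest shift falls to the first row, which is already
    counted. There are at most two, one after each zero of the word.\<close>
  let ?Z = "{c. c < n \<and> W i (int c - 1) = 0}"
  have kinj: "inj_on ?k {..<n}"
  proof -
    have "inj_on (\<lambda>c. (c + (block_base G i + (\<lambda>_. 0) (int c))) mod n) {..<n}"
      by (rule inj_on_shift) (auto simp: word_mod_def)
    then show ?thesis by simp
  qed
  have w: "word_mod n (W i)" "proper_word (W i)"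
    using words iN by (auto simp: block_words_def)
  have Z: "card ?Z \<le> 2"
  proof -
    have "card ?Z \<le> card {a, x i}"
    proof (rule card_inj_on_le[of "\<lambda>c. (int c - 1) mod int n"])
      show "inj_on (\<lambda>c. (int c - 1) mod int n) ?Z"
      proof (rule inj_onI)
        fix c c' assume c: "c \<in> ?Z" "c' \<in> ?Z" "(int c - 1) mod int n = (int c' - 1) mod int n"
        then have "[int c - 1 = int c' - 1] (mod int n)" by (simp add: cong_def)
        then have "[int c = int c'] (mod int n)" by (simp add: cong_iff_dvd_diff)
        then have "[c = c'] (mod n)" by (simp add: cong_int_iff)
        then show "c = c'" using c by (simp add: cong_less_modulus_unique_nat)
      qed
      show "(\<lambda>c. (int c - 1) mod int n) ` ?Z \<subseteq> {a, x i}"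
      proof
        fix y assume "y \<in> (\<lambda>c. (int c - 1) mod int n) ` ?Z"
        then obtain c where c: "y = (int c - 1) mod int n" "W i (int c - 1) = 0" by blast
        have "[y = int c - 1] (mod int n)" by (simp add: c(1) cong_def)
        then have "W i y = 0" using word_modD[OF w(1)] c(2) by metis
        moreover have "y \<in> {0..<int n}" using n'(3) by (simp add: c(1))
        ultimately show "y \<in> {a, x i}" using anchored[OF i] by blast
      qed
    qed simp
    also have "\<dots> \<le> 2" by (simp add: card_insert_if)
    finally show ?thesis .
  qed
  let ?Q = "{c. c < n \<and> c \<notin> cols \<union> ?Z \<and> ?k c \<notin> syms}"
  have "n \<le> card ?Q + card (cols \<union> ?Z) + card syms"
    by (rule card_avoiding[OF kinj]) auto
  then have Q: "n \<le> card ?Q + card cols + 2 + card syms"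
    using card_Un_le[of cols ?Z] Z by linarith
  let ?f = "\<lambda>c. (?r, c, ?h c)"
  let ?g = "\<lambda>c. (block_row G i (W i (int c - 1)), c, ?k c)"
  have f: "?f ` ?P \<subseteq> band_free i"
    using row by (auto simp: band_free_def unforced_def shifted_square_def)
  have gQ: "block_shift G N W (block_row G i (W i (int c - 1))) c = block_base G i"
    "W i (int c - 1) \<in> {1, 2}" if "c \<in> ?Q" for c
  proof -
    have "W i (int c - 1) < 3" using w(2) by (simp add: proper_word_def)
    moreover have "W i (int c - 1) \<noteq> 0" using that by auto
    ultimately show "W i (int c - 1) \<in> {1, 2}" by (auto simp: numeral_3_eq_3 numeral_2_eq_2 less_Suc_eq)
    have "W i (int c - 1) \<noteq> W i (int c)" by (rule proper_word_pred[OF w(2)])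
    then show "block_shift G N W (block_row G i (W i (int c - 1))) c = block_base G i"
      using \<open>_ < 3\<close> iN by (simp add: block_val_def band_def)
  qed
  have g: "?g ` ?Q \<subseteq> band_free i"
  proof
    fix e assume "e \<in> ?g ` ?Q"
    then obtain c where c: "c \<in> ?Q" "e = ?g c" by blast
    have "W i (int c - 1) < 3" using gQ(2)[OF c(1)] by auto
    then have "e \<in> unforced"
      using c gQ(1)[OF c(1)] row by (simp add: unforced_def shifted_square_def)
    then show "e \<in> band_free i" using c gQ[OF c(1)] unfolding band_free_def by auto
  qed
  have disj: "?f ` ?P \<inter> ?g ` ?Q = {}"
  proof -
    have "?r \<noteq> block_row G i (W i (int c - 1))" if "c \<in> ?Q" for c
      using gQ(2)[OF that] block_row_inject[of G i 0 i "W i (int c - 1)"] by auto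
    then show ?thesis by blast
  qed
  have fin: "finite (band_free i)"
    by (rule finite_subset[OF _ finite_L]) (auto simp: band_free_def unforced_def)
  have "card ?P + card ?Q = card (?f ` ?P) + card (?g ` ?Q)"
    by (simp add: card_image inj_on_def)
  also have "\<dots> = card (?f ` ?P \<union> ?g ` ?Q)"
    by (rule card_Un_disjoint[symmetric]) (use disj in auto)
  also have "\<dots> \<le> card (band_free i)"
    by (rule card_mono[OF fin]) (use f g in blast)
  finally show ?thesis using P Q cK by linarith
qed

text \<open>A column and a symbol determine an entry, and by \<open>forced_inj\<close> exactly
  \<open>card K\<close> columns and \<open>card K\<close> symbols are forbidden.\<close>

lemma card_unforced:
  assumes T: "transversal n L T"
  shows "card unforced \<le> (n - card K) * (n - card K)"
proof -
  note inj = forced_inj[OF T]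
  have sub: "cols \<subseteq> {..<n}" "syms \<subseteq> {..<n}" using x_range n'(3) by (auto simp: nat_less_iff)
  have c: "card ({..<n} - cols) = n - card K" "card ({..<n} - syms) = n - card K"
    using sub inj by (simp_all add: card_Diff_subset card_image)
  have "card unforced \<le> card (({..<n} - cols) \<times> ({..<n} - syms))"
  proof (rule card_inj_on_le[of "\<lambda>(r, c, s). (c, s)"])
    show "inj_on (\<lambda>(r, c, s). (c, s)) unforced"
    proof (rule inj_onI)
      fix e e' assume e: "e \<in> unforced" "e' \<in> unforced" "(\<lambda>(r, c, s). (c, s)) e = (\<lambda>(r, c, s). (c, s)) e'"
      obtain r c s r' where ee: "e = (r, c, s)" "e' = (r', c, s)" using e(3) by (cases e; cases e') auto
      then have L: "(r, c, s) \<in> L" "(r', c, s) \<in> L" using e by (auto simp: unforced_def)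
      then have "c < n" "s < n" using n'(3) by (auto simp: shifted_square_def)
      then have "r = r'" using latin L unfolding latin_square_def by blast
      then show "e = e'" using ee by simp
    qed
    show "(\<lambda>(r, c, s). (c, s)) ` unforced \<subseteq> ({..<n} - cols) \<times> ({..<n} - syms)"
      using shifted_square_subset[OF n'(3)] by (fastforce simp: unforced_def)
  qed simp
  then show ?thesis unfolding card_cartesian_product c .
qed

text \<open>With \<open>q = card K\<close>, at most \<open>q\<close> forced entries and
  \<open>(n - q) * (n - q) - q * (2 * n - 4 * q - 2)\<close> others can lie in transversals.
  Subtracting from \<open>n * n\<close> leaves the bound; for \<open>q\<close> near
  \<open>n / 6\<close> its quadratic part is \<open>4 / 6 - 5 / 36 = 19 / 36\<close> of the
  square.\<close>

lemma tau_bound: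
  assumes T0: "transversal n L T0"
  shows "4 * int n * int (card K) - 5 * (int (card K))\<^sup>2 - 3 * int (card K) \<le> int (tau n L)"
proof -
  let ?free = "{e. transversal_free n L e}"
  let ?q = "card K"
  have sub: "?free \<subseteq> L" by (auto simp: transversal_free_def)
  have fin: "finite unforced" by (rule finite_subset[OF _ finite_L]) (auto simp: unforced_def)
  have bf: "band_free i \<subseteq> unforced" for i by (auto simp: band_free_def)
  have nonfree: "L - ?free \<subseteq> forced ` K \<union> (unforced - (\<Union>i\<in>K. band_free i))"
  proof
    fix e assume e: "e \<in> L - ?free"
    then obtain T where T: "transversal n L T" "e \<in> T" by (auto simp: transversal_free_def)
    obtain r c s where rcs: "e = (r, c, s)" by (cases e)
    show "e \<in> forced ` K \<union> (unforced - (\<Union>i\<in>K. band_free i))"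
    proof (cases "e \<in> forced ` K")
      case False
      note entry = transversal_entry[OF T(1) T(2)[unfolded rcs] False[unfolded rcs]]
      have "e \<in> unforced" using e rcs entry by (simp add: unforced_def)
      moreover have "e \<notin> band_free i" if i: "i \<in> K" for i
      proof
        assume "e \<in> band_free i"
        moreover have "r \<noteq> block_row G i 0" using entry(3) i by blast
        ultimately obtain j where "j \<in> {1, 2}"
          and jr: "r = block_row G i j" "block_shift G N W r c = block_base G i"
          unfolding band_free_def rcs by blast
        then have j: "j < 3" "r = block_row G i j" "block_shift G N W r c = block_base G i" by auto
        then have "top_shift G N r = block_base G i" using entry(4) by simp
        moreover have "top_shift G N r = block_top G i" using j i by simp
        ultimately show False by (simp add: block_top_def split: if_splits)
      qed
      ultimately show ?thesis by blast
    qed simp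
  qed
  have disj: "\<forall>i\<in>K. \<forall>i'\<in>K. i \<noteq> i' \<longrightarrow> band_free i \<inter> band_free i' = {}"
  proof -
    have "i = i'" if e1: "e \<in> band_free i" and e2: "e \<in> band_free i'" for e i i'
    proof -
      have row: "\<exists>j \<in> {..<3}. fst e = block_row G i j" if "e \<in> band_free i" for i
        using that unfolding band_free_def lessThan_3 by fastforce
      obtain j j' where "j < 3" "j' < 3" "block_row G i j = block_row G i' j'"
        using row[OF e1] row[OF e2] by auto
      then show ?thesis using block_row_inject[of G i j i' j'] by simp
    qed
    then show ?thesis by blast
  qed
  have "card (\<Union>i\<in>K. band_free i) = (\<Sum>i\<in>K. card (band_free i))"
    by (rule card_UN_disjoint[OF _ _ disj]) (use finite_subset[OF bf fin] in auto)
  moreover have "(\<Sum>i\<in>K. 2 * n) \<le> (\<Sum>i\<in>K. card (band_free i) + (4 * ?q + 2))"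
    by (rule sum_mono) (use card_band_free in fastforce)
  ultimately have U: "?q * (2 * n) \<le> card (\<Union>i\<in>K. band_free i) + ?q * (4 * ?q + 2)"
    by (simp only: sum.distrib sum_constant of_nat_id add_mult_distrib2)
  have UN: "(\<Union>i\<in>K. band_free i) \<subseteq> unforced" using bf by blast
  have "card (L - ?free) \<le> card (forced ` K \<union> (unforced - (\<Union>i\<in>K. band_free i)))"
    by (rule card_mono[OF _ nonfree]) (use fin in auto)
  also have "\<dots> \<le> card (forced ` K) + card (unforced - (\<Union>i\<in>K. band_free i))"
    by (rule card_Un_le)
  finally have 1: "card (L - ?free) \<le> ?q + (card unforced - card (\<Union>i\<in>K. band_free i))"
    using card_Diff_subset[OF finite_subset[OF UN fin] UN] card_image_le[of K forced] by fastforce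
  have 2: "card (\<Union>i\<in>K. band_free i) \<le> card unforced" by (rule card_mono[OF fin UN])
  have 3: "card (L - ?free) = n * n - tau n L" "tau n L \<le> n * n"
    using card_Diff_subset[OF finite_subset[OF sub finite_L] sub] card_mono[OF finite_L sub]
    by (simp_all add: tau_def card_shifted_square)
  have "?q \<le> n" using n by simp
  then have 4: "int (card unforced) \<le> (int n - int ?q) * (int n - int ?q)"
    using card_unforced[OF T0] by (metis of_nat_diff of_nat_le_iff of_nat_mult)
  have 5: "int ?q * (2 * int n) \<le> int (card (\<Union>i\<in>K. band_free i)) + int ?q * (4 * int ?q + 2)"
    using U by (metis (mono_tags, lifting) of_nat_add of_nat_le_iff of_nat_mult of_nat_numeral)
  have "int n * int n - int (tau n L) \<le> int ?q + (int (card unforced) - int (card (\<Union>i\<in>K. band_free i)))"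
    using 1 2 3 by (simp add: of_nat_diff flip: of_nat_mult)
  then show "4 * int n * int ?q - 5 * (int ?q)\<^sup>2 - 3 * int ?q \<le> int (tau n L)"
    using 4 5 by (simp add: algebra_simps power2_eq_square)
qed

end

text \<open>Small orders: one switched intercalate creates a transversal in the cyclic square.\<close>

lemma ex_latin_square_transversal:
  assumes m: "2 \<le> m" and n: "n = 2 * m"
  shows "\<exists>g T. latin_square n (shifted_square n g) \<and> transversal n (shifted_square n g) T"
proof -
  \<comment> \<open>Rows \<open>m - 1\<close> and \<open>n - 1\<close> differ by half of
    \<open>n\<close>, as do columns \<open>0\<close> and \<open>m\<close>, so these four cells form
    an intercalate.\<close>
  define g where "g r c = (if c \<in> {0, m} then transpose (m - 1) (n - 1) r else r)" for r c :: nat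
  have "latin_square n (shifted_square n g)"
  proof (rule latin_square_shifted)
    show "g r c < n" if "r < n" for r c
      using that m n by (auto simp: g_def transpose_def)
    show "inj_on (\<lambda>r. g r c) {..<n}" for c
    proof (cases "c \<in> {0, m}")
      case True
      then have "(\<lambda>r. g r c) = transpose (m - 1) (n - 1)" by (auto simp: g_def)
      then show ?thesis by simp
    next
      case False
      then have "(\<lambda>r. g r c) = id" by (auto simp: g_def)
      then show ?thesis by simp
    qed
    show "inj_on (\<lambda>c. (c + g r c) mod n) {..<n}" if "r < n" for r
    proof -
      \<comment> \<open>Along a row, the switch amounts to exchanging columns \<open>0\<close> and
        \<open>m\<close>.\<close>
      define h where "h = (if r \<in> {m - 1, n - 1} then transpose 0 m else id)"
      have h: "inj h" "h c < n" if "c < n" for c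
        using that m n by (auto simp: h_def transpose_def)
      have hg: "[c + g r c = h c + r] (mod n)" for c
      proof -
        have "[0 + (n - 1) = m + (m - 1)] (mod n)" "[m + (n - 1) = 0 + (m - 1)] (mod n)"
          "[0 + (m - 1) = m + (n - 1)] (mod n)" "[m + (m - 1) = 0 + (n - 1)] (mod n)"
          using m n by (auto simp: cong_def mod_if)
        then show ?thesis using m n by (auto simp: g_def h_def transpose_def)
      qed
      show ?thesis
      proof (rule inj_onI)
        fix c c' assume c: "c \<in> {..<n}" "c' \<in> {..<n}" and eq: "(c + g r c) mod n = (c' + g r c') mod n"
        have "[h c + r = h c' + r] (mod n)"
          using eq hg[of c] hg[of c'] by (simp add: cong_def)
        then have "[h c = h c'] (mod n)" by (simp only: cong_add_rcancel_nat)
        then have "h c = h c'" using h c by (simp add: cong_less_modulus_unique_nat)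
        then show "c = c'" using h(1) c by (auto dest: injD)
      qed
    qed
  qed
  moreover
  \<comment> \<open>Rows below \<open>m\<close> give the even symbols, rows from \<open>m\<close> to
    \<open>n - 2\<close> the odd symbols up to \<open>n - 3\<close>. The missing
    \<open>n - 1\<close> comes from the switched cell in row \<open>n - 1\<close> and column
    \<open>m\<close>.\<close>
  define c where "c r = (if r < m then r else if r < n - 1 then r + 1 else m)" for r
  define s where "s r = (if r < m then 2 * r else if r < n - 1 then 2 * r + 1 - n else n - 1)" for r
  define e where "e r = (r, c r, s r)" for r
  have "e r \<in> shifted_square n g" if r: "r < n" for r
  proof -
    consider "r < m" | "m \<le> r" "r < n - 1" | "r = n - 1" using r by linarith
    then have "s r = (c r + g r (c r)) mod n"
    proof cases
      case 1
      then have "g r (c r) = r" using m n by (auto simp: g_def c_def transpose_def)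
      then show ?thesis using 1 n by (simp add: c_def s_def)
    next
      case 2
      then have "g r (c r) = r" using m n by (auto simp: g_def c_def)
      moreover have "c r + r = s r + n" "s r < n" using 2 m n by (auto simp: c_def s_def)
      ultimately show ?thesis by simp
    next
      case 3
      then have "g r (c r) = m - 1" using m n by (auto simp: g_def c_def)
      moreover have "c r + (m - 1) = s r" "s r < n" using 3 m n by (auto simp: c_def s_def)
      ultimately show ?thesis by simp
    qed
    moreover have "c r < n" using m n r by (auto simp: c_def)
    ultimately show ?thesis using r by (simp add: e_def shifted_square_def)
  qed
  then have "e ` {..<n} \<subseteq> shifted_square n g" by auto
  moreover have "card (e ` {..<n}) = n"
    by (subst card_image) (auto simp: inj_on_def e_def)
  moreover have "c ` {..<n} = {..<n}"
  proof (rule endo_inj_surj)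
    show "c ` {..<n} \<subseteq> {..<n}" using m n by (auto simp: c_def)
    show "inj_on c {..<n}" using m n by (auto simp: c_def inj_on_def split: if_splits)
  qed simp
  moreover have "s ` {..<n} = {..<n}"
  proof (rule endo_inj_surj)
    show "s ` {..<n} \<subseteq> {..<n}" using m n by (auto simp: s_def)
    show "inj_on s {..<n}"
    proof (rule inj_onI)
      have odd: "odd (s r) \<longleftrightarrow> m \<le> r" if "r < n" for r using m n that by (auto simp: s_def)
      fix y z assume yz: "y \<in> {..<n}" "z \<in> {..<n}" "s y = s z"
      then have "m \<le> y \<longleftrightarrow> m \<le> z" using odd[of y] odd[of z] by simp
      then show "y = z" using yz m n by (auto simp: s_def split: if_splits)
    qed
  qed simp
  ultimately have "transversal n (shifted_square n g) (e ` {..<n})"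
    by (simp add: transversal_def image_image e_def atLeast0LessThan)
  with \<open>latin_square n (shifted_square n g)\<close> show ?thesis by blast
qed

section \<open>Choice of parameters and conclusion\<close>

lemma ex_block_parameters:
  assumes "21 \<le> (m::nat)"
  obtains G N where "0 < G" "G \<le> 3" "G + 2 \<le> N" "m = 3 * N + 2 * G"
proof -
  \<comment> \<open>The residue of \<open>m\<close> fixes \<open>G\<close> in
    \<open>{1, 2, 3}\<close> through \<open>2 * G\<close> being congruent to \<open>m\<close> modulo
    \<open>3\<close>. The value \<open>m = 18\<close> would still give \<open>G = 3\<close> and
    \<open>N = 4\<close>, too few bands.\<close>
  have "m mod 3 = 0 \<or> m mod 3 = 1 \<or> m mod 3 = 2" by linarith
  then show thesis
  proof (elim disjE)
    assume "m mod 3 = 0"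
    then have "m = 3 * ((m - 6) div 3) + 2 * 3" using assms by presburger
    then show thesis using assms by (intro that[of 3 "(m - 6) div 3"]) auto
  next
    assume "m mod 3 = 1"
    then have "m = 3 * ((m - 4) div 3) + 2 * 2" using assms by presburger
    then show thesis using assms by (intro that[of 2 "(m - 4) div 3"]) auto
  next
    assume "m mod 3 = 2"
    then have "m = 3 * ((m - 2) div 3) + 2 * 1" using assms by presburger
    then show thesis using assms by (intro that[of 1 "(m - 2) div 3"]) auto
  qed
qed

lemma ex_latin_square_large:
  assumes m: "21 \<le> m" and n: "n = 2 * m"
  shows "\<exists>L. latin_square n L \<and> tau n L < n ^ 2 \<and> real (tau n L) \<ge> 19 / 36 * real n ^ 2 - 30 * real n"
proof -
  obtain G N where GN: "0 < G" "G \<le> 3" "G + 2 \<le> N" "m = 3 * N + 2 * G"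
    using ex_block_parameters[OF m] .
  have bd: "0 < n" "even n" "16 \<le> n" "G + 3 * N \<le> n" "G \<le> N" using m n GN by auto
  have "int n dvd (\<Sum>r<n. int (top_shift G N r))"
    using sum_top_shift[OF n GN(4) bd(5)] by (simp flip: of_nat_sum)
  then have "[(\<Sum>r<n. int (top_shift G N r)) = 0] (mod int n)" by (simp add: cong_0_iff)
  from Hall_differences[OF bd(1) this] obtain \<sigma> where \<sigma>: "bij_betw \<sigma> {..<n} {0..<int n}"
    "bij_betw (\<lambda>r. (int (top_shift G N r) + \<sigma> r) mod int n) {..<n} {0..<int n}" .
  show ?thesis
  proof (rule ex_block_words[OF bd(2,3,4) GN(3) \<sigma>(1)])
    fix W a b x assume W: "block_words n G N W"
    "\<And>i. i < N \<Longrightarrow> inj_on (\<lambda>j. W i (\<sigma> (block_row G i j))) {..<3}"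
    "\<And>i c. i \<in> {G, G + 1} \<Longrightarrow> c \<in> {0..<int n} \<Longrightarrow> W i c = 0 \<longleftrightarrow> c = a \<or> c = b"
    "\<And>i c. i \<in> {G + 2..<N} \<Longrightarrow> c \<in> {0..<int n} \<Longrightarrow> W i c = 0 \<longleftrightarrow> c = a \<or> c = x i"
    "\<And>i. i \<in> {G + 2..<N} \<Longrightarrow> x i \<in> {0..<int n}"
    interpret anchored_blocks n m G N W a b x
      by unfold_locales (fact n GN W)+
    obtain T where T: "transversal n L T"
      using ex_block_transversal[OF W(1) bd(4,5) \<sigma> W(2)] by blast
    define q where "q = card K"
    have q: "3 * q + 5 * G + 6 = m" using GN by (simp add: q_def)
    have "4 * int n * int q - 5 * (int q)\<^sup>2 - 3 * int q \<le> int (tau n L)"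
      unfolding q_def by (rule tau_bound[OF T])
    then have "real_of_int (4 * int n * int q - 5 * (int q)\<^sup>2 - 3 * int q) \<le> real_of_int (int (tau n L))"
      by (simp only: of_int_le_iff)
    then have tau: "4 * (real n * real q) - 5 * (real q)\<^sup>2 - 3 * real q \<le> real (tau n L)"
      by simp
    \<comment> \<open>\<open>n = 6 * q + 10 * G + 12\<close>, and \<open>G\<close> is at most
      \<open>3\<close>.\<close>
    have "n \<le> 6 * q + 42" "6 * q \<le> n" using q GN(2) n by auto
    then have "real n \<le> 6 * real q + 42" "6 * real q \<le> real n" by linarith+
    then have 1: "real n / 6 - 7 \<le> real q" and 2: "real q \<le> real n / 6" by auto
    have "real n * (real n / 6 - 7) \<le> real n * real q" using 1 by (intro mult_left_mono) auto
    moreover have "(real q)\<^sup>2 \<le> (real n / 6)\<^sup>2" using 2 by (intro power_mono) auto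
    \<comment> \<open>The linear losses are \<open>4 * 7 = 28\<close> from the lower bound on
      \<open>q\<close> and \<open>3 / 6\<close> from the term \<open>3 * q\<close>, together below
      \<open>30\<close>.\<close>
    ultimately have "19 / 36 * real n ^ 2 - 30 * real n \<le> real (tau n L)"
      using tau 2 by (simp add: power2_eq_square algebra_simps)
    then show ?thesis using latin tau_less[OF T bd(1)] by blast
  qed
qed

theorem theorem2:
  shows "\<exists>C::real. \<forall>n::nat. even n \<and> n \<ge> 10 \<longrightarrow>
           (\<exists>L. latin_square n L \<and> tau n L < n ^ 2 \<and>
                real (tau n L) \<ge> 19 / 36 * real n ^ 2 - C * real n)"
proof (rule exI[of _ 30], intro allI impI)
  fix n :: nat assume n: "even n \<and> n \<ge> 10"
  then obtain m where m: "n = 2 * m" by blast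
  show "\<exists>L. latin_square n L \<and> tau n L < n ^ 2 \<and>
    real (tau n L) \<ge> 19 / 36 * real n ^ 2 - 30 * real n"
  proof (cases "21 \<le> m")
    case True
    then show ?thesis using m by (rule ex_latin_square_large)
  next
    case False
    obtain g T where gT: "latin_square n (shifted_square n g)" "transversal n (shifted_square n g) T"
      using ex_latin_square_transversal[OF _ m] n m by auto
    \<comment> \<open>For such small \<open>n\<close> the claimed lower bound is not positive, so
      any square with a transversal will do.\<close>
    have "real n * real n \<le> 42 * real n" using False m by (intro mult_right_mono) auto
    then have "19 / 36 * real n ^ 2 - 30 * real n \<le> 0" by (simp add: power2_eq_square)
    also have "0 \<le> real (tau n (shifted_square n g))" by simp
    finally show ?thesis using gT tau_less[OF gT(2)] n by auto
  qed
qed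

end
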